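(* Let $\Phi$ and $\Psi$ be arbitrary random measures on $\mathbb{R}^d$ (defined on a common probability space, not assumed stationary). (a) There exists a point process $P$ that is a translation-equivariant factor of $(\Phi,\Psi)$ and that is nonempty almost surely, if and only if $(\Phi,\Psi)$ has no invariant direction almost surely. (b) There exists a point process $P$ that is a translation-equivariant factor of $\Phi$ and that is nonempty almost surely, if and only if $\Phi$ has no invariant direction almost surely.
   Context: Let $\mathcal{M}$ be the set of locally finite Borel measures on $\mathbb{R}^d$, equipped with its usual Polish topology (the vague topology, metrized by a modification of the Prokhorov metric) and the corresponding Borel $\sigma$-field. A random measure is a random element of $\mathcal{M}$. For $\varphi\in\mathcal{M}$ and $t\in\mathbb{R}^d$, the translate $\varphi+t\in\mathcal{M}$ is defined by $(\varphi+t)(A):=\varphi(A-t)$ for Borel $A\subseteq\mathbb{R}^d$. A (simple) point process is a random measure that is almost surely the counting measure of a discrete (locally finite) subset of $\mathbb{R}^d$; it is identified with that random discrete subset, and it is nonempty if this subset is nonempty. A point process $P$ is a translation-equivariant factor (also called a translation-invariant factor) of $\Phi$ if $P=P(\Phi)$ is a measurable function of $\Phi$ such that, for almost every sample of $\Phi$, $P(\Phi+t)=P(\Phi)+t$ for every $t\in\mathbb{R}^d$. A factor of the pair $(\Phi,\Psi)$ is defined in the same way: $P=P(\Phi,\Psi)$ is a measurable function of $(\Phi,\Psi)\in\mathcal{M}\times\mathcal{M}$ such that, for almost every sample of $(\Phi,\Psi)$, $P(\Phi+t,\Psi+t)=P(\Phi,\Psi)+t$ for every $t\in\mathbb{R}^d$.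 An invariant direction of $(\Phi,\Psi)$ is a vector $t\in\mathbb{R}^d\setminus\{0\}$ such that $\Phi+\lambda t=\Phi$ and $\Psi+\lambda t=\Psi$ for all $\lambda\in\mathbb{R}$. An invariant direction of $\Phi$ is a vector $t\in\mathbb{R}^d\setminus\{0\}$ such that $\Phi+\lambda t=\Phi$ for all $\lambda\in\mathbb{R}$. *)

theory Defs
  imports "HOL-Probability.Probability"
begin

definition locally_finite_measures :: "'a::euclidean_space measure set" where
  "locally_finite_measures =
     {\<mu>. sets \<mu> = sets borel \<and> (\<forall>K. compact K \<longrightarrow> emeasure \<mu> K < \<infinity>)}"

text \<open>The coarsest topology on the locally finite measures for which \<open>\<mu> \<mapsto> \<integral> f d\<mu>\<close> is
  continuous for every continuous compactly supported \<open>f\<close>.\<close>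

definition vague_topology :: "'a::euclidean_space measure topology" where
  "vague_topology = topology_generated_by
     {{\<mu> \<in> locally_finite_measures. (\<integral>x. f x \<partial>\<mu>) \<in> U} | (f :: 'a \<Rightarrow> real) U.
        continuous_on UNIV f \<and> compact (closure {x. f x \<noteq> 0}) \<and> open U}"

lemma topspace_vague_topology [simp]:
  "topspace vague_topology = (locally_finite_measures :: 'a::euclidean_space measure set)"
proof -
  have "(locally_finite_measures :: 'a measure set) \<in>
     {{\<mu> \<in> locally_finite_measures. (\<integral>x. f x \<partial>\<mu>) \<in> U} | (f :: 'a \<Rightarrow> real) U.
        continuous_on UNIV f \<and> compact (closure {x. f x \<noteq> 0}) \<and> open U}"
    by (rule CollectI, rule exI[of _ "\<lambda>_. 0"], rule exI[of _ UNIV]) auto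
  then show ?thesis
    unfolding vague_topology_def topology_generated_by_topspace by blast
qed

definition borel_of :: "'b topology \<Rightarrow> 'b measure" where
  "borel_of X = sigma (topspace X) {U. openin X U}"

abbreviation vague_borel :: "'a::euclidean_space measure measure" where
  "vague_borel \<equiv> borel_of vague_topology"

lemma space_borel_of [simp]: "space (borel_of X) = topspace X"
  unfolding borel_of_def using openin_subset by (auto intro!: space_measure_of)

lemma sets_borel_of: "sets (borel_of X) = sigma_sets (topspace X) {U. openin X U}"
  unfolding borel_of_def using openin_subset by (auto intro!: sets_measure_of)

definition random_measure :: "'w measure \<Rightarrow> ('w \<Rightarrow> 'a::euclidean_space measure) \<Rightarrow> bool" where
  "random_measure \<Omega> \<Phi> \<longleftrightarrow> \<Phi> \<in> measurable \<Omega> vague_borel"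

definition translate :: "'a::euclidean_space measure \<Rightarrow> 'a \<Rightarrow> 'a measure" where
  "translate \<phi> t = distr \<phi> borel (\<lambda>x. x + t)"

lemma emeasure_translate:
  assumes "\<phi> \<in> locally_finite_measures" "A \<in> sets borel"
  shows "emeasure (translate \<phi> t) A = emeasure \<phi> ((\<lambda>x. x - t) ` A)"
proof -
  have s: "sets \<phi> = sets borel"
    using assms(1) by (simp add: locally_finite_measures_def)
  then have "space \<phi> = UNIV"
    using sets_eq_imp_space_eq[OF s] by simp
  moreover have "(\<lambda>x. x + t) -` A = (\<lambda>x. x - t) ` A"
    by (auto intro!: image_eqI[of _ _ "_ + t"])
  moreover have "(\<lambda>x. x + t) \<in> measurable \<phi> borel"
    unfolding measurable_cong_sets[OF s refl] by simp
  ultimately show ?thesis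
    unfolding translate_def by (simp add: emeasure_distr assms(2))
qed

definition locally_finite_set :: "'a::euclidean_space set \<Rightarrow> bool" where
  "locally_finite_set S \<longleftrightarrow> (\<forall>K. compact K \<longrightarrow> finite (S \<inter> K))"

definition counting_measure :: "'a::euclidean_space set \<Rightarrow> 'a measure" where
  "counting_measure S = distr (count_space S) borel (\<lambda>x. x)"

lemma emeasure_counting_measure:
  assumes "A \<in> sets borel"
  shows "emeasure (counting_measure S) A = emeasure (count_space UNIV) (A \<inter> S)"
  unfolding counting_measure_def
  using assms by (simp add: emeasure_distr emeasure_count_space)

lemma counting_measure_inject: "counting_measure S = counting_measure T \<longleftrightarrow> S = T"
proof
  assume eq: "counting_measure S = counting_measure T"
  have "x \<in> S \<longleftrightarrow> x \<in> T" for x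
  proof -
    have "emeasure (count_space UNIV) ({x} \<inter> S) = emeasure (count_space UNIV) ({x} \<inter> T)"
      using eq emeasure_counting_measure[of "{x}"] by (metis borel_singleton sets.empty_sets)
    then show ?thesis
      by (cases "x \<in> S"; cases "x \<in> T") (auto simp: emeasure_count_space)
  qed
  then show "S = T" by blast
qed simp

definition point_process :: "'w measure \<Rightarrow> ('w \<Rightarrow> 'a::euclidean_space measure) \<Rightarrow> bool" where
  "point_process \<Omega> P \<longleftrightarrow> random_measure \<Omega> P \<and>
     (AE \<omega> in \<Omega>. \<exists>S. locally_finite_set S \<and> P \<omega> = counting_measure S)"

text \<open>By \<open>counting_measure_inject\<close> the set \<open>S\<close> below is the one identified with \<open>P \<omega>\<close>.\<close>

definition nonempty_almost_surely ::
    "'w measure \<Rightarrow> ('w \<Rightarrow> 'a::euclidean_space measure) \<Rightarrow> bool" where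
  "nonempty_almost_surely \<Omega> P \<longleftrightarrow>
     (AE \<omega> in \<Omega>. \<exists>S. locally_finite_set S \<and> P \<omega> = counting_measure S \<and> S \<noteq> {})"

definition equivariant_factor ::
    "'w measure \<Rightarrow> ('w \<Rightarrow> 'a::euclidean_space measure) \<Rightarrow> ('w \<Rightarrow> 'a measure) \<Rightarrow> bool" where
  "equivariant_factor \<Omega> \<Phi> P \<longleftrightarrow>
     (\<exists>F \<in> measurable vague_borel vague_borel.
        (\<forall>\<omega> \<in> space \<Omega>. P \<omega> = F (\<Phi> \<omega>)) \<and>
        (AE \<omega> in \<Omega>. \<forall>t. F (translate (\<Phi> \<omega>) t) = translate (F (\<Phi> \<omega>)) t))"

definition equivariant_factor_pair ::
    "'w measure \<Rightarrow> ('w \<Rightarrow> 'a::euclidean_space measure) \<Rightarrow> ('w \<Rightarrow> 'a measure) \<Rightarrow>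
     ('w \<Rightarrow> 'a measure) \<Rightarrow> bool" where
  "equivariant_factor_pair \<Omega> \<Phi> \<Psi> P \<longleftrightarrow>
     (\<exists>F \<in> measurable (vague_borel \<Otimes>\<^sub>M vague_borel) vague_borel.
        (\<forall>\<omega> \<in> space \<Omega>. P \<omega> = F (\<Phi> \<omega>, \<Psi> \<omega>)) \<and>
        (AE \<omega> in \<Omega>. \<forall>t. F (translate (\<Phi> \<omega>) t, translate (\<Psi> \<omega>) t)
                          = translate (F (\<Phi> \<omega>, \<Psi> \<omega>)) t))"

definition invariant_direction :: "'a::euclidean_space measure \<Rightarrow> 'a \<Rightarrow> bool" where
  "invariant_direction \<phi> t \<longleftrightarrow> t \<noteq> 0 \<and> (\<forall>l::real. translate \<phi> (l *\<^sub>R t) = \<phi>)"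

definition invariant_direction_pair ::
    "'a::euclidean_space measure \<Rightarrow> 'a measure \<Rightarrow> 'a \<Rightarrow> bool" where
  "invariant_direction_pair \<phi> \<psi> t \<longleftrightarrow>
     t \<noteq> 0 \<and> (\<forall>l::real. translate \<phi> (l *\<^sub>R t) = \<phi> \<and> translate \<psi> (l *\<^sub>R t) = \<psi>)"

end

theory Submission
  imports Defs
begin

text \<open>A nonempty locally finite set is not invariant under all multiples of a nonzero vector, so an
  invariant direction excludes a nonempty factor.

  Conversely, the stabilizer of \<open>p = (\<phi>, \<psi>)\<close> under translations is a closed subgroup; without an
  invariant direction it contains no line, hence is discrete. For countably many test functions
  \<open>f\<close>, the profiles \<open>y \<mapsto> \<integral>f (x - y) d\<phi>(x)\<close> (and likewise for \<open>\<psi>\<close>) are continuous and together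
  determine \<open>p\<close>. By compactness finitely many of them separate the origin from a whole annulus
  \<open>r \<le> norm y \<le> R * r\<close> below the minimal norm of the stabilizer. So for suitable rational targets
  \<open>c\<close>, the set of points where these profiles are within \<open>d\<close> of \<open>c\<close>, while being uniformly farther
  than \<open>d\<close> from \<open>c\<close> on the annulus around the point, is nonempty. It is open, equivariant, and
  splits into clusters of diameter at most \<open>r\<close> at mutual distance at least \<open>R * r\<close>. The
  coordinatewise infima of the clusters form a uniformly discrete equivariant set; the first
  choice of the countably many parameters for which it is nonempty gives the factor. Part (b) is
  part (a) with \<open>\<Psi> = \<Phi>\<close>.\<close>

section \<open>The vague topology\<close>

definition Cc :: "('a::euclidean_space \<Rightarrow> real) set" where
  "Cc = {f. continuous_on UNIV f \<and> compact (closure {x. f x \<noteq> 0})}"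

text \<open>In a Euclidean space the closure of a set is compact exactly when the set is bounded, so
  compact support can be handled as vanishing outside a ball.\<close>

lemma Cc_iff: "f \<in> Cc \<longleftrightarrow> continuous_on UNIV f \<and> (\<exists>m. \<forall>x. norm x > m \<longrightarrow> f x = 0)"
proof -
  have "compact (closure {x. f x \<noteq> 0}) \<longleftrightarrow> (\<exists>m. \<forall>x. norm x > m \<longrightarrow> f x = 0)"
    unfolding compact_closure bounded_iff by (metis (mono_tags) linorder_not_le mem_Collect_eq)
  then show ?thesis
    by (simp add: Cc_def)
qed

lemma Cc_bounded:
  assumes "f \<in> Cc"
  obtains m C where "m > 0" "C > 0" "\<And>x. norm x > m \<Longrightarrow> f x = 0" "\<And>x. \<bar>f x\<bar> \<le> C"
proof -
  obtain m where m: "\<And>x. norm x > m \<Longrightarrow> f x = 0" and c: "continuous_on UNIV f"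
    using assms unfolding Cc_iff by blast
  have "compact (f ` cball 0 m)"
    by (intro compact_continuous_image continuous_on_subset[OF c]) auto
  then have "bounded (f ` cball 0 m)" by (rule compact_imp_bounded)
  then obtain C where "\<forall>y\<in>f ` cball 0 m. norm y \<le> C" unfolding bounded_iff by blast
  then have C: "\<And>x. norm x \<le> m \<Longrightarrow> \<bar>f x\<bar> \<le> C" by simp
  show ?thesis
  proof (rule that[of "max 1 m" "max 1 C"])
    show "\<bar>f x\<bar> \<le> max 1 C" for x
      using C[of x] m[of x] by (cases "norm x \<le> m") auto
  qed (use m in auto)
qed

lemma Cc_borel: "f \<in> Cc \<Longrightarrow> f \<in> borel_measurable borel"
  by (simp add: Cc_def borel_measurable_continuous_onI)

lemma Cc_shift:
  assumes "f \<in> Cc"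
  shows "(\<lambda>x. f (x + t)) \<in> Cc"
proof -
  obtain m where m: "\<And>x. norm x > m \<Longrightarrow> f x = 0" and c: "continuous_on UNIV f"
    using assms unfolding Cc_iff by blast
  have "f (x + t) = 0" if "norm x > m + norm t" for x
    using m[of "x + t"] norm_diff_ineq[of x t] that by simp
  moreover have "continuous_on UNIV (\<lambda>x. f (x + t))"
    by (intro continuous_on_compose2[OF c] continuous_intros) auto
  ultimately show ?thesis
    unfolding Cc_iff by blast
qed

text \<open>The support of the combination lies in the union of the two supports, because
  \<open>h 0 0 = 0\<close>. Differences and maxima are the instances of interest.\<close>

lemma Cc_binary:
  assumes "f \<in> Cc" "g \<in> Cc" "h 0 0 = (0::real)"
    and "continuous_on UNIV (\<lambda>x. h (f x) (g x))"
  shows "(\<lambda>x. h (f x) (g x)) \<in> Cc"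
proof -
  obtain m m' where "\<And>x. norm x > m \<Longrightarrow> f x = 0" "\<And>x. norm x > m' \<Longrightarrow> g x = 0"
    using assms(1,2) unfolding Cc_iff by blast
  then have "\<forall>x. norm x > max m m' \<longrightarrow> h (f x) (g x) = 0"
    using assms(3) by simp
  then show ?thesis
    using assms(4) unfolding Cc_iff by blast
qed

lemma Cc_diff: "f \<in> Cc \<Longrightarrow> g \<in> Cc \<Longrightarrow> (\<lambda>x. f x - g x) \<in> Cc"
  by (rule Cc_binary) (auto simp: Cc_def intro!: continuous_intros)

lemma Cc_max: "f \<in> Cc \<Longrightarrow> g \<in> Cc \<Longrightarrow> (\<lambda>x. max (f x) (g x)) \<in> Cc"
  by (rule Cc_binary) (auto simp: Cc_def intro!: continuous_intros)

lemma Cc_uminus: "f \<in> Cc \<Longrightarrow> (\<lambda>x. - f x) \<in> Cc"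
  using Cc_diff[of "\<lambda>_. 0" f] by (simp add: Cc_iff)

lemma lfm_sets: "\<mu> \<in> locally_finite_measures \<Longrightarrow> sets \<mu> = sets borel"
  by (simp add: locally_finite_measures_def)

lemma lfm_borel_measurable:
  "\<mu> \<in> locally_finite_measures \<Longrightarrow> borel_measurable \<mu> = borel_measurable borel"
  by (intro measurable_cong_sets lfm_sets refl)

lemma lfm_integrable_indicator:
  assumes "\<mu> \<in> locally_finite_measures" "compact K"
  shows "integrable \<mu> (indicat_real K)"
  using assms lfm_sets[OF assms(1)]
  by (auto simp: locally_finite_measures_def intro!: integrable_real_indicator borel_compact)

lemma lfm_integrable_bounded:
  fixes f :: "'a::euclidean_space \<Rightarrow> real"
  assumes \<mu>: "\<mu> \<in> locally_finite_measures" and f: "f \<in> borel_measurable borel"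
    and b: "\<And>x. \<bar>f x\<bar> \<le> C" "\<And>x. norm x > m \<Longrightarrow> f x = 0"
  shows "integrable \<mu> f"
proof (rule Bochner_Integration.integrable_bound)
  show "integrable \<mu> (\<lambda>x. C * indicat_real (cball 0 m) x)"
    by (intro integrable_mult_right lfm_integrable_indicator[OF \<mu>]) auto
  show "AE x in \<mu>. norm (f x) \<le> norm (C * indicat_real (cball 0 m) x)"
  proof (rule AE_I2)
    fix x
    show "norm (f x) \<le> norm (C * indicat_real (cball 0 m) x)"
      using b(1)[of x] b(2)[of x] by (cases "norm x \<le> m") auto
  qed
qed (simp add: f lfm_borel_measurable[OF \<mu>])

lemma Cc_integrable: "f \<in> Cc \<Longrightarrow> \<mu> \<in> locally_finite_measures \<Longrightarrow> integrable \<mu> f"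
  by (metis Cc_bounded Cc_borel lfm_integrable_bounded)

section \<open>A countable family of tent functions\<close>

text \<open>One fixed sequence meeting every nonempty open set. It supplies the centres of the tents
  and, later, the probes that turn quantifiers over points into countable ones.\<close>

definition dense_seq :: "nat \<Rightarrow> 'a::euclidean_space" where
  "dense_seq = from_nat_into (SOME B. countable B \<and> (\<forall>X. open X \<and> X \<noteq> {} \<longrightarrow> (\<exists>b\<in>B. b \<in> X)))"

lemma dense_seq:
  assumes "open X" "x \<in> X"
  obtains k where "dense_seq k \<in> (X :: 'a::euclidean_space set)"
proof -
  define B :: "'a set" where
    "B = (SOME B. countable B \<and> (\<forall>X. open X \<and> X \<noteq> {} \<longrightarrow> (\<exists>b\<in>B. b \<in> X)))"
  have B: "countable B \<and> (\<forall>X. open X \<and> X \<noteq> {} \<longrightarrow> (\<exists>b\<in>B. b \<in> X))"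
    unfolding B_def by (rule someI_ex) (metis countable_dense_exists)
  then obtain b where "b \<in> B" "b \<in> X"
    using assms by blast
  moreover from this obtain k where "from_nat_into B k = b"
    using B by (metis from_nat_into_surj)
  ultimately show ?thesis
    using that[of k] unfolding dense_seq_def B_def[symmetric] by simp
qed

type_synonym tent_code = "nat \<times> nat \<times> rat"

text \<open>A cone of height \<open>c\<close> and slope \<open>n + 1\<close> over
  \<open>dense_seq k\<close>, cut off at 0. The slope is at least 1, which bounds the support; the
  rational height keeps the codes countable.\<close>

definition tent :: "tent_code \<Rightarrow> 'a::euclidean_space \<Rightarrow> real" where
  "tent = (\<lambda>(k, n, c) x. max 0 (of_rat c - real (Suc n) * norm (x - dense_seq k)))"

primrec tent_sup :: "tent_code list \<Rightarrow> 'a::euclidean_space \<Rightarrow> real" where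
  "tent_sup [] x = 0"
| "tent_sup (t # L) x = max (tent t x) (tent_sup L x)"

lemma tent_Cc: "tent t \<in> Cc"
proof -
  obtain k n c where t: "t = (k, n, c)" by (cases t)
  have "tent t x = 0" if "norm x > norm (dense_seq k :: 'a) + of_rat c" for x :: 'a
  proof -
    have "norm (x - dense_seq k) > of_rat c"
      using norm_triangle_ineq2[of x "dense_seq k"] that by simp
    moreover have "real (Suc n) * norm (x - dense_seq k) \<ge> norm (x - dense_seq k)"
      by (simp add: distrib_right)
    ultimately show ?thesis by (simp add: tent_def t)
  qed
  moreover have "continuous_on UNIV (tent t :: 'a \<Rightarrow> real)"
    unfolding tent_def t by (auto intro!: continuous_intros)
  ultimately show ?thesis
    unfolding Cc_iff by blast
qed

lemma tent_sup_Cc: "tent_sup L \<in> Cc"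
proof (induction L)
  case Nil
  then show ?case by (auto simp: Cc_iff)
next
  case (Cons t L)
  have "(tent_sup (t # L) :: 'a \<Rightarrow> real) = (\<lambda>x. max (tent t x) (tent_sup L x))" by auto
  then show ?case using Cc_max[OF tent_Cc Cons] by simp
qed

lemma tent_sup_nonneg: "0 \<le> tent_sup L x"
  by (induction L) auto

lemma tent_le_tent_sup: "t \<in> set L \<Longrightarrow> tent t x \<le> tent_sup L x"
  by (induction L) auto

lemma tent_sup_le: "0 \<le> b \<Longrightarrow> (\<And>t. t \<in> set L \<Longrightarrow> tent t x \<le> b) \<Longrightarrow> tent_sup L x \<le> b"
  by (induction L) auto

text \<open>By continuity \<open>f\<close> exceeds a rational \<open>c > a\<close> on a ball around
  \<open>x0\<close>; a steep cone of height \<open>c\<close> centred near \<open>x0\<close> has its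
  support inside that ball.\<close>

lemma tent_below:
  fixes f :: "'a::euclidean_space \<Rightarrow> real"
  assumes cont: "continuous_on UNIV f" and pos: "\<And>x. 0 \<le> f x" and a: "a < f x0"
  obtains t where "\<And>x. tent t x \<le> f x" "a < tent t x0"
proof (cases "a < 0")
  case True
  show ?thesis
  proof (rule that[of "(0, 0, 0)"])
    show "tent (0,0,0) x \<le> f x" for x using pos by (simp add: tent_def)
    show "a < tent (0,0,0) x0" using True by (simp add: tent_def)
  qed
next
  case False
  obtain c where c: "a < of_rat c" "of_rat c < f x0"
    using of_rat_dense[OF a] by blast
  have "0 < (of_rat c :: real)" using c(1) False by linarith
  then have c0: "0 < c" by simp
  have "open (f -` {of_rat c<..})"
    by (rule open_vimage[OF open_greaterThan cont])
  then obtain d where d: "d > 0" "\<And>x. dist x x0 < d \<Longrightarrow> of_rat c < f x"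
    using c(2) unfolding open_dist by force
  \<comment> \<open>The slope makes the base radius of the cone less than \<open>d/2\<close>. The
    bound \<open>s\<close> below keeps the centre within \<open>d/2\<close> of \<open>x0\<close> and
    the loss of height at \<open>x0\<close> below \<open>c - a\<close>.\<close>
  obtain n where n: "of_rat c / (d/2) < real (Suc n)"
    by (metis reals_Archimedean2 lessI of_nat_less_iff less_trans)
  define s where "s = min (d/2) ((of_rat c - a) / Suc n)"
  have "s > 0" using d c by (simp add: s_def)
  then obtain k where k: "dense_seq k \<in> ball x0 s"
    using dense_seq[of "ball x0 s" x0] by auto
  then have k1: "dist x0 (dense_seq k) < d/2" and "norm (x0 - dense_seq k) < (of_rat c - a) / Suc n"
    by (auto simp: s_def dist_norm)
  then have k2: "real (Suc n) * norm (x0 - dense_seq k) < of_rat c - a"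
    by (simp add: field_simps del: of_nat_Suc)
  show ?thesis
  proof (rule that[of "(k, n, c)"])
    show "a < tent (k, n, c) x0"
      using k2 by (simp add: tent_def)
    fix x
    show "tent (k, n, c) x \<le> f x"
    proof (cases "real (Suc n) * norm (x - dense_seq k) < of_rat c")
      case True
      also have "of_rat c < real (Suc n) * (d/2)"
        using n d by (simp add: field_simps)
      finally have "dist x (dense_seq k) < d/2"
        by (simp add: dist_norm mult_less_cancel_left del: of_nat_Suc)
      then have "dist x x0 < d"
        using k1 dist_triangle_half_l[of x "dense_seq k" d x0] by (simp add: dist_commute)
      then have "of_rat c < f x" using d(2) by simp
      moreover have "tent (k, n, c) x \<le> of_rat c"
        using c0 by (simp add: tent_def)
      ultimately show ?thesis by simp
    next
      case False
      then have "tent (k, n, c) x = 0" by (simp add: tent_def del: of_nat_Suc)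
      then show ?thesis using pos by simp
    qed
  qed
qed

text \<open>By \<open>tent_below\<close>, \<open>f\<close> is the pointwise supremum of the
  countably many tents below it. Maxima of finitely many of these converge to \<open>f\<close> and
  are dominated by \<open>f\<close>, so their integrals converge as well.\<close>

lemma tent_sup_integral_below:
  fixes f :: "'a::euclidean_space \<Rightarrow> real"
  assumes f: "f \<in> Cc" and pos: "\<And>x. 0 \<le> f x" and \<mu>: "\<mu> \<in> locally_finite_measures"
    and a: "a < (\<integral>x. f x \<partial>\<mu>)"
  obtains L where "\<And>x. tent_sup L x \<le> f x" "a < (\<integral>x. tent_sup L x \<partial>\<mu>)"
proof -
  have cont: "continuous_on UNIV f" using f by (simp add: Cc_def)
  define J where "J = {t. \<forall>x. tent t x \<le> f x}"
  have "(0, 0, 0) \<in> J" using pos by (auto simp: J_def tent_def)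
  then have ne: "J \<noteq> {}" by blast
  define E where "E = (\<lambda>n. tent_sup (map (from_nat_into J) [0..<n]) :: 'a \<Rightarrow> real)"
  have le: "E n x \<le> f x" for n x
    unfolding E_def using from_nat_into[OF ne] pos by (intro tent_sup_le) (auto simp: J_def)
  have lim: "(\<lambda>n. E n x) \<longlonglongrightarrow> f x" for x
  proof (rule order_tendstoI)
    fix b assume "b < f x"
    then obtain t where t: "\<And>x. tent t x \<le> f x" "b < tent t x"
      using tent_below[OF cont pos] by blast
    then have "t \<in> J" by (simp add: J_def)
    then obtain i where i: "from_nat_into J i = t"
      using from_nat_into_surj[OF countableI_type] by blast
    have "b < E n x" if "n > i" for n
    proof -
      have "tent t x \<le> E n x"
        unfolding E_def using that i by (intro tent_le_tent_sup) force
      then show ?thesis using t by simp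
    qed
    then show "\<forall>\<^sub>F n in sequentially. b < E n x"
      by (meson eventually_sequentiallyI Suc_le_eq)
  next
    fix b assume "f x < b"
    then show "\<forall>\<^sub>F n in sequentially. E n x < b"
      using le by (intro always_eventually) (meson le_less_trans)
  qed
  have "(\<lambda>n. \<integral>x. E n x \<partial>\<mu>) \<longlonglongrightarrow> (\<integral>x. f x \<partial>\<mu>)"
  proof (rule integral_dominated_convergence)
    show "f \<in> borel_measurable \<mu>" "E n \<in> borel_measurable \<mu>" for n
      unfolding lfm_borel_measurable[OF \<mu>] E_def using f by (auto intro: Cc_borel tent_sup_Cc)
    show "integrable \<mu> f" by (rule Cc_integrable[OF f \<mu>])
    show "AE x in \<mu>. norm (E n x) \<le> f x" for n
      using le[of n] by (intro AE_I2) (simp add: E_def tent_sup_nonneg)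
  qed (use lim in auto)
  then have "\<forall>\<^sub>F n in sequentially. a < (\<integral>x. E n x \<partial>\<mu>)"
    by (rule order_tendstoD) (rule a)
  then obtain n where "a < (\<integral>x. E n x \<partial>\<mu>)"
    by (auto simp: eventually_sequentially)
  then show ?thesis
    using that le unfolding E_def by blast
qed

text \<open>These sets turn out to form a countable base of the vague topology.\<close>

definition basic_nbhd :: "(tent_code list \<times> rat \<times> rat) list \<Rightarrow> 'a::euclidean_space measure set" where
  "basic_nbhd L = {\<mu> \<in> locally_finite_measures. \<forall>(K, p, q) \<in> set L.
     (\<integral>x. tent_sup K x \<partial>\<mu>) \<in> {of_rat p<..<of_rat q}}"

lemma basic_nbhd_append: "basic_nbhd (L @ L') = basic_nbhd L \<inter> basic_nbhd L'"
  unfolding basic_nbhd_def set_append ball_Un by blast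

text \<open>An upper bound on \<open>\<integral>f\<close> follows from an upper bound on \<open>\<integral>\<chi>\<close> and a lower bound on
  \<open>\<integral>(\<chi> - f)\<close>, where \<open>\<chi>\<close> is a tent above \<open>f\<close>; the lower bound is inherited from a
  \<open>tent_sup\<close> below \<open>\<chi> - f \<ge> 0\<close>.\<close>

lemma basic_nbhd_integral_less:
  fixes f :: "'a::euclidean_space \<Rightarrow> real"
  assumes f: "f \<in> Cc" and \<mu>: "\<mu> \<in> locally_finite_measures" and b: "(\<integral>x. f x \<partial>\<mu>) < b"
  obtains L where "\<mu> \<in> basic_nbhd L" "\<And>\<nu>. \<nu> \<in> basic_nbhd L \<Longrightarrow> (\<integral>x. f x \<partial>\<nu>) < b"
proof -
  obtain m C where mC: "m > 0" "C > 0" "\<And>x. norm x > m \<Longrightarrow> f x = 0" "\<And>x. \<bar>f x\<bar> \<le> C"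
    using Cc_bounded[OF f] by metis
  obtain k where k: "dense_seq k \<in> ball (0::'a) 1"
    using dense_seq[of "ball (0::'a) 1" 0] by auto
  \<comment> \<open>On the ball of radius \<open>m\<close> a cone of slope 1 centred within 1 of the
    origin loses at most \<open>m + 1\<close> of its height, so it stays above \<open>C\<close> and
    hence above \<open>f\<close>.\<close>
  obtain c where c: "C + m + 1 < of_rat c"
    using of_rat_dense[of "C + m + 1" "C + m + 2"] by auto
  define K where "K = [(k, 0, c) :: tent_code]"
  have fK: "f x \<le> tent_sup K x" for x
  proof (cases "norm x \<le> m")
    case True
    have "norm (x - dense_seq k) \<le> m + 1"
      using True k norm_triangle_ineq4[of x "dense_seq k"] by auto
    then show ?thesis using c mC(4)[of x] by (auto simp: K_def tent_def)
  next
    case False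
    then show ?thesis using mC(3)[of x] tent_sup_nonneg[of K x] by simp
  qed
  have I: "(\<integral>x. tent_sup K x - f x \<partial>\<nu>) = (\<integral>x. tent_sup K x \<partial>\<nu>) - (\<integral>x. f x \<partial>\<nu>)"
    if "\<nu> \<in> locally_finite_measures" for \<nu>
    using that f by (intro Bochner_Integration.integral_diff Cc_integrable tent_sup_Cc)
  have "(\<integral>x. tent_sup K x \<partial>\<mu>) - b < (\<integral>x. tent_sup K x - f x \<partial>\<mu>)"
    using b I[OF \<mu>] by simp
  then obtain L where L: "\<And>x. tent_sup L x \<le> tent_sup K x - f x"
      "(\<integral>x. tent_sup K x \<partial>\<mu>) - b < (\<integral>x. tent_sup L x \<partial>\<mu>)"
    using tent_sup_integral_below[OF Cc_diff[OF tent_sup_Cc f] _ \<mu>, of K] fK by auto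
  \<comment> \<open>The margin \<open>s\<close> is split evenly between the upper bound
    \<open>u\<close> for the integral of \<open>K\<close> and the lower bound \<open>v\<close> for
    that of \<open>L\<close>, so that \<open>u - v < b\<close>. The far endpoints \<open>u'\<close>
    and \<open>v'\<close> only complete the intervals of \<open>basic_nbhd\<close>.\<close>
  define s where "s = (\<integral>x. tent_sup L x \<partial>\<mu>) - (\<integral>x. tent_sup K x \<partial>\<mu>) + b"
  have s: "s > 0" using L(2) by (simp add: s_def)
  obtain u where u: "(\<integral>x. tent_sup K x \<partial>\<mu>) < of_rat u" "of_rat u < (\<integral>x. tent_sup K x \<partial>\<mu>) + s/2"
    using of_rat_dense[of "\<integral>x. tent_sup K x \<partial>\<mu>" "(\<integral>x. tent_sup K x \<partial>\<mu>) + s/2"] s by auto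
  obtain v where v: "(\<integral>x. tent_sup L x \<partial>\<mu>) - s/2 < of_rat v" "of_rat v < (\<integral>x. tent_sup L x \<partial>\<mu>)"
    using of_rat_dense[of "(\<integral>x. tent_sup L x \<partial>\<mu>) - s/2" "\<integral>x. tent_sup L x \<partial>\<mu>"] s by auto
  obtain u' where u': "of_rat u' < (\<integral>x. tent_sup K x \<partial>\<mu>)"
    using of_rat_dense[of "(\<integral>x. tent_sup K x \<partial>\<mu>) - 1" "\<integral>x. tent_sup K x \<partial>\<mu>"] by auto
  obtain v' where v': "(\<integral>x. tent_sup L x \<partial>\<mu>) < of_rat v'"
    using of_rat_dense[of "(\<integral>x. tent_sup L x \<partial>\<mu>)" "(\<integral>x. tent_sup L x \<partial>\<mu>) + 1"] by auto
  show ?thesis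
  proof (rule that[of "[(K, u', u), (L, v, v')]"])
    show "\<mu> \<in> basic_nbhd [(K, u', u), (L, v, v')]"
      using \<mu> u v u' v' by (simp add: basic_nbhd_def)
    fix \<nu> :: "'a measure" assume \<nu>: "\<nu> \<in> basic_nbhd [(K, u', u), (L, v, v')]"
    then have \<nu>': "\<nu> \<in> locally_finite_measures" and *: "(\<integral>x. tent_sup K x \<partial>\<nu>) < of_rat u"
        "of_rat v < (\<integral>x. tent_sup L x \<partial>\<nu>)"
      by (auto simp: basic_nbhd_def)
    have "(\<integral>x. tent_sup L x \<partial>\<nu>) \<le> (\<integral>x. tent_sup K x - f x \<partial>\<nu>)"
      using L(1) f \<nu>' by (intro integral_mono Cc_integrable Cc_diff tent_sup_Cc) auto
    then show "(\<integral>x. f x \<partial>\<nu>) < b"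
      using I[OF \<nu>'] * u(2) v(1) s_def by linarith
  qed
qed

text \<open>An upper bound for the integral of \<open>- f\<close> is a lower bound for that of
  \<open>f\<close>, so two uses of \<open>basic_nbhd_integral_less\<close> confine the integral to
  an interval inside \<open>U\<close>.\<close>

lemma basic_nbhd_integral_open:
  fixes f :: "'a::euclidean_space \<Rightarrow> real"
  assumes f: "f \<in> Cc" and \<mu>: "\<mu> \<in> locally_finite_measures"
    and U: "open U" "(\<integral>x. f x \<partial>\<mu>) \<in> U"
  obtains L where "\<mu> \<in> basic_nbhd L" "\<And>\<nu>. \<nu> \<in> basic_nbhd L \<Longrightarrow> (\<integral>x. f x \<partial>\<nu>) \<in> U"
proof -
  obtain e where e: "e > 0" "\<And>y. dist y (\<integral>x. f x \<partial>\<mu>) < e \<Longrightarrow> y \<in> U"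
    using U unfolding open_dist by blast
  obtain L where L: "\<mu> \<in> basic_nbhd L" "\<And>\<nu>. \<nu> \<in> basic_nbhd L \<Longrightarrow> (\<integral>x. f x \<partial>\<nu>) < (\<integral>x. f x \<partial>\<mu>) + e"
    using basic_nbhd_integral_less[OF f \<mu>, of "(\<integral>x. f x \<partial>\<mu>) + e"] e(1) by auto
  obtain L' where L': "\<mu> \<in> basic_nbhd L'"
      "\<And>\<nu>. \<nu> \<in> basic_nbhd L' \<Longrightarrow> (\<integral>x. - f x \<partial>\<nu>) < (\<integral>x. - f x \<partial>\<mu>) + e"
    using basic_nbhd_integral_less[OF Cc_uminus[OF f] \<mu>, of "(\<integral>x. - f x \<partial>\<mu>) + e"] e(1) by auto
  show ?thesis
  proof (rule that[of "L @ L'"])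
    show "\<mu> \<in> basic_nbhd (L @ L')" using L L' by (simp add: basic_nbhd_append)
    fix \<nu> :: "'a measure" assume "\<nu> \<in> basic_nbhd (L @ L')"
    then show "(\<integral>x. f x \<partial>\<nu>) \<in> U"
      using L(2)[of \<nu>] L'(2)[of \<nu>]
      by (intro e(2)) (auto simp: basic_nbhd_append dist_real_def)
  qed
qed

text \<open>Induction over the generation of the topology: concatenated codes handle intersections,
  and \<open>basic_nbhd_integral_open\<close> handles the generators.\<close>

lemma openin_vague_basic_nbhd:
  assumes "openin vague_topology U" "\<mu> \<in> U"
  obtains L where "\<mu> \<in> basic_nbhd L" "basic_nbhd L \<subseteq> (U :: 'a::euclidean_space measure set)"
proof -
  have "generate_topology_on {{\<mu> \<in> locally_finite_measures. (\<integral>x. f x \<partial>\<mu>) \<in> U} | (f :: 'a \<Rightarrow> real) U.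
        continuous_on UNIV f \<and> compact (closure {x. f x \<noteq> 0}) \<and> open U} U"
    using assms(1) unfolding vague_topology_def openin_topology_generated_by_iff .
  then have "\<forall>\<mu>\<in>U. \<exists>L. \<mu> \<in> basic_nbhd L \<and> basic_nbhd L \<subseteq> U"
  proof induction
    case Empty
    then show ?case by simp
  next
    case (Int a b)
    show ?case
    proof
      fix \<mu> assume "\<mu> \<in> a \<inter> b"
      then obtain L L' where "\<mu> \<in> basic_nbhd L" "basic_nbhd L \<subseteq> a" "\<mu> \<in> basic_nbhd L'" "basic_nbhd L' \<subseteq> b"
        using Int by blast
      then show "\<exists>L. \<mu> \<in> basic_nbhd L \<and> basic_nbhd L \<subseteq> a \<inter> b"
        by (intro exI[of _ "L @ L'"]) (auto simp: basic_nbhd_append)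
    qed
  next
    case (UN K)
    then show ?case by blast
  next
    case (Basis s)
    then obtain f :: "'a \<Rightarrow> real" and V
      where s: "s = {\<mu> \<in> locally_finite_measures. (\<integral>x. f x \<partial>\<mu>) \<in> V}" and f: "f \<in> Cc" "open V"
      unfolding Cc_def by blast
    show ?case
    proof
      fix \<mu> assume "\<mu> \<in> s"
      then obtain L where L: "\<mu> \<in> basic_nbhd L" "\<And>\<nu>. \<nu> \<in> basic_nbhd L \<Longrightarrow> (\<integral>x. f x \<partial>\<nu>) \<in> V"
        using basic_nbhd_integral_open[OF f(1) _ f(2)] unfolding s by blast
      then have "basic_nbhd L \<subseteq> s" unfolding s by (auto simp: basic_nbhd_def)
      then show "\<exists>L. \<mu> \<in> basic_nbhd L \<and> basic_nbhd L \<subseteq> s" using L by blast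
    qed
  qed
  then show ?thesis using assms(2) that by blast
qed

section \<open>Measurability and uniqueness through integrals of test functions\<close>

text \<open>An open set is the union of the basic neighbourhoods inside it, and there are only
  countably many codes. The preimage of each is cut out by finitely many integrals.\<close>

lemma measurable_vague_borelI:
  fixes H :: "'b \<Rightarrow> 'a::euclidean_space measure"
  assumes H: "\<And>x. x \<in> space M \<Longrightarrow> H x \<in> locally_finite_measures"
    and meas: "\<And>f. f \<in> Cc \<Longrightarrow> (\<lambda>x. \<integral>y. f y \<partial>H x) \<in> borel_measurable M"
  shows "H \<in> measurable M vague_borel"
  unfolding borel_of_def
proof (rule measurable_measure_of)
  have basic: "H -` basic_nbhd L \<inter> space M \<in> sets M" for L
  proof -
    have [measurable]: "(\<lambda>x. \<integral>y. tent_sup K y \<partial>H x) \<in> borel_measurable M" for K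
      by (rule meas[OF tent_sup_Cc])
    have "{x \<in> space M. \<forall>z\<in>set L. (\<integral>y. tent_sup (fst z) y \<partial>H x) \<in> {of_rat (fst (snd z))<..<of_rat (snd (snd z))}} \<in> sets M"
      by measurable
    also have "{x \<in> space M. \<forall>z\<in>set L. (\<integral>y. tent_sup (fst z) y \<partial>H x) \<in> {of_rat (fst (snd z))<..<of_rat (snd (snd z))}}
        = H -` basic_nbhd L \<inter> space M"
      using H by (auto simp: basic_nbhd_def split_beta)
    finally show ?thesis .
  qed
  fix U :: "'a measure set" assume "U \<in> {U. openin vague_topology U}"
  then have "U = (\<Union>L\<in>{L. basic_nbhd L \<subseteq> U}. basic_nbhd L)"
    using openin_vague_basic_nbhd[of U] by blast
  then have "H -` U \<inter> space M = (\<Union>L\<in>{L. basic_nbhd L \<subseteq> U}. H -` basic_nbhd L \<inter> space M)"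
    by blast
  also have "\<dots> \<in> sets M"
    by (rule sets.countable_UN'[OF countableI_type]) (use basic in blast)
  finally show "H -` U \<inter> space M \<in> sets M" .
qed (use H openin_subset[of vague_topology] in auto)

lemma vague_integral_measurable:
  fixes f :: "'a::euclidean_space \<Rightarrow> real"
  assumes "f \<in> Cc"
  shows "(\<lambda>\<mu>. \<integral>x. f x \<partial>\<mu>) \<in> borel_measurable vague_borel"
proof (rule borel_measurableI)
  fix U :: "real set" assume "open U"
  then have "{\<mu> \<in> locally_finite_measures. (\<integral>x. f x \<partial>\<mu>) \<in> U} \<in> {U. openin vague_topology U}"
    using assms unfolding vague_topology_def Cc_def
    by (auto intro!: topology_generated_by_Basis)
  then show "(\<lambda>\<mu>. \<integral>x. f x \<partial>\<mu>) -` U \<inter> space vague_borel \<in> sets vague_borel"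
    unfolding sets_borel_of by (intro sigma_sets.Basic) (simp add: vimage_def Int_def conj_commute)
qed

text \<open>Integrals of \<open>tent_sup\<close> functions determine those of all functions in
  \<open>Cc\<close>, these determine the measures of open boxes by approximation, and boxes form a
  generating family stable under intersection.\<close>

lemma lfm_eqI:
  fixes \<mu> \<nu> :: "'a::euclidean_space measure"
  assumes \<mu>: "\<mu> \<in> locally_finite_measures" and \<nu>: "\<nu> \<in> locally_finite_measures"
    and eq: "\<And>L. (\<integral>x. tent_sup L x \<partial>\<mu>) = (\<integral>x. tent_sup L x \<partial>\<nu>)"
  shows "\<mu> = \<nu>"
proof -
  have le: "(\<integral>x. f x \<partial>\<mu>) \<le> (\<integral>x. f x \<partial>\<nu>)" if f: "f \<in> Cc"
    and \<mu>: "\<mu> \<in> locally_finite_measures" and \<nu>: "\<nu> \<in> locally_finite_measures"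
    and eq: "\<And>L. (\<integral>x. tent_sup L x \<partial>\<mu>) = (\<integral>x. tent_sup L x \<partial>\<nu>)" for f and \<mu> \<nu> :: "'a measure"
  proof (rule dense_ge)
    fix b assume "(\<integral>x. f x \<partial>\<nu>) < b"
    then obtain L where L: "\<nu> \<in> basic_nbhd L" "\<And>\<nu>. \<nu> \<in> basic_nbhd L \<Longrightarrow> (\<integral>x. f x \<partial>\<nu>) < b"
      using basic_nbhd_integral_less[OF f \<nu>] by blast
    \<comment> \<open>Basic neighbourhoods see a measure only through its \<open>tent_sup\<close>
      integrals, so they cannot separate the two measures.\<close>
    have "\<mu> \<in> basic_nbhd L" using L(1) eq \<mu> by (simp add: basic_nbhd_def)
    then show "(\<integral>x. f x \<partial>\<mu>) \<le> b" using L(2) less_imp_le by blast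
  qed
  have C: "(\<integral>x. f x \<partial>\<mu>) = (\<integral>x. f x \<partial>\<nu>)" if "f \<in> Cc" for f
    using le[OF that \<mu> \<nu> eq] le[OF that \<nu> \<mu> eq[symmetric]] by simp
  have box: "emeasure \<mu> (box a b) = emeasure \<nu> (box a b)" for a b
  proof -
    \<comment> \<open>These functions vanish off the box and tend to its indicator, since the
      distance to the closed complement is positive at every point of the box.\<close>
    define f where "f = (\<lambda>n x. min 1 (real n * infdist x (- box a b)))"
    have ne: "- box a b \<noteq> {}"
      by (metis boolean_algebra.compl_zero bounded_box double_compl not_bounded_UNIV)
    obtain m where m: "\<And>x. x \<in> box a b \<Longrightarrow> norm x \<le> m"
      using bounded_box[of a b] unfolding bounded_iff by blast
    have zero: "f n x = 0" if "x \<notin> box a b" for n x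
      using that by (simp add: f_def)
    have fC: "f n \<in> Cc" for n
      unfolding Cc_iff
    proof
      show "continuous_on UNIV (f n)"
        unfolding f_def by (intro continuous_intros continuous_on_min)
      show "\<exists>m. \<forall>x. m < norm x \<longrightarrow> f n x = 0"
        using m zero by (meson linorder_not_le)
    qed
    have lim: "(\<lambda>n. f n x) \<longlonglongrightarrow> indicat_real (box a b) x" for x
    proof (cases "x \<in> box a b")
      case True
      have "closed (- box a b)" by (simp add: closed_Compl open_box)
      then have pos: "infdist x (- box a b) > 0"
        using True ne in_closed_iff_infdist_zero[of "- box a b" x] infdist_nonneg[of x "- box a b"]
        by (simp add: less_le)
      obtain N where N: "1 / infdist x (- box a b) < real N" using reals_Archimedean2 by blast
      have "f n x = 1" if "n \<ge> N" for n
      proof -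
        have "1 / infdist x (- box a b) < real n" using N that by simp
        then show ?thesis using pos by (simp add: f_def field_simps)
      qed
      then have "\<forall>\<^sub>F n in sequentially. f n x = 1"
        by (rule eventually_sequentiallyI)
      then show ?thesis using True by (simp add: tendsto_eventually)
    next
      case False
      then show ?thesis using zero by simp
    qed
    have conv: "(\<lambda>n. \<integral>x. f n x \<partial>\<rho>) \<longlonglongrightarrow> measure \<rho> (box a b)" and fin: "emeasure \<rho> (box a b) \<noteq> \<infinity>"
      if \<rho>: "\<rho> \<in> locally_finite_measures" for \<rho>
    proof -
      have i: "integrable \<rho> (indicat_real (box a b))"
        by (rule lfm_integrable_bounded[OF \<rho>, of _ 1 m])
           (auto simp: indicator_def dest: m)
      have sp: "space \<rho> = UNIV" using sets_eq_imp_space_eq[OF lfm_sets[OF \<rho>]] by simp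
      have "(\<lambda>n. \<integral>x. f n x \<partial>\<rho>) \<longlonglongrightarrow> (\<integral>x. indicat_real (box a b) x \<partial>\<rho>)"
      proof (rule integral_dominated_convergence)
        show "indicat_real (box a b) \<in> borel_measurable \<rho>" "f n \<in> borel_measurable \<rho>" for n
          using fC i unfolding lfm_borel_measurable[OF \<rho>] by (auto intro: Cc_borel)
        show "integrable \<rho> (indicat_real (box a b))" by (rule i)
        show "AE x in \<rho>. norm (f n x) \<le> indicat_real (box a b) x" for n
          using zero[of _ n] by (intro AE_I2) (auto simp: f_def indicator_def infdist_nonneg)
      qed (use lim in auto)
      then show "(\<lambda>n. \<integral>x. f n x \<partial>\<rho>) \<longlonglongrightarrow> measure \<rho> (box a b)"
        by (simp add: sp)
      show "emeasure \<rho> (box a b) \<noteq> \<infinity>"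
        using i unfolding integrable_indicator_iff by (simp add: sp less_top)
    qed
    have "measure \<mu> (box a b) = measure \<nu> (box a b)"
      using LIMSEQ_unique[OF conv(1)[OF \<mu>]] conv(1)[OF \<nu>] C[OF fC] by simp
    then show ?thesis
      using fin[OF \<mu>] fin[OF \<nu>] by (simp add: emeasure_eq_ennreal_measure)
  qed
  show ?thesis
  proof (rule measure_eqI_generator_eq)
    let ?E = "range (\<lambda>(a, b). box a b :: 'a set)"
    let ?A = "\<lambda>n::nat. box (- (real n *\<^sub>R One)) (real n *\<^sub>R One) :: 'a set"
    show "Int_stable ?E" by (auto simp: Int_stable_def box_Int_box)
    show "?E \<subseteq> Pow UNIV" "sets \<mu> = sigma_sets UNIV ?E" "sets \<nu> = sigma_sets UNIV ?E"
      by (simp_all add: borel_eq_box lfm_sets[OF \<mu>] lfm_sets[OF \<nu>])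
    show "range ?A \<subseteq> ?E" "(\<Union>i. ?A i) = UNIV"
      unfolding UN_box_eq_UNIV by auto
    show "emeasure \<mu> (?A i) \<noteq> \<infinity>" for i
    proof -
      have "emeasure \<mu> (?A i) \<le> emeasure \<mu> (cbox (- (real i *\<^sub>R One)) (real i *\<^sub>R One))"
        using lfm_sets[OF \<mu>] by (intro emeasure_mono box_subset_cbox) auto
      also have "\<dots> < \<infinity>" using \<mu> by (simp add: locally_finite_measures_def)
      finally show ?thesis by simp
    qed
    show "emeasure \<mu> X = emeasure \<nu> X" if "X \<in> ?E" for X
      using that box by auto
  qed
qed

section \<open>Translations and local profiles\<close>

lemma lfm_borel_measurableI:
  assumes "\<mu> \<in> locally_finite_measures" "f \<in> measurable borel N"
  shows "f \<in> measurable \<mu> N"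
  using assms(2) measurable_cong_sets[OF lfm_sets[OF assms(1)] refl] by auto

lemma translate_lfm:
  assumes "\<phi> \<in> locally_finite_measures"
  shows "translate \<phi> t \<in> locally_finite_measures"
proof -
  have "emeasure (translate \<phi> t) K < \<infinity>" if K: "compact K" for K
  proof -
    have "compact ((\<lambda>x. x - t) ` K)"
      using K by (intro compact_continuous_image continuous_intros)
    then show ?thesis
      using assms K by (subst emeasure_translate[OF assms])
        (auto simp: locally_finite_measures_def borel_compact)
  qed
  then show ?thesis
    by (simp add: locally_finite_measures_def translate_def)
qed

lemma integral_translate:
  fixes f :: "'a::euclidean_space \<Rightarrow> real"
  assumes "\<phi> \<in> locally_finite_measures" "f \<in> borel_measurable borel"
  shows "(\<integral>x. f x \<partial>translate \<phi> t) = (\<integral>x. f (x + t) \<partial>\<phi>)"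
  unfolding translate_def
  by (rule integral_distr[OF lfm_borel_measurableI[OF assms(1)] assms(2)]) simp

lemma translate_translate:
  assumes "\<phi> \<in> locally_finite_measures"
  shows "translate (translate \<phi> s) t = translate \<phi> (s + t)"
  unfolding translate_def
  by (subst distr_distr) (auto intro!: lfm_borel_measurableI[OF assms] simp: o_def add.assoc)

lemma translate_0:
  assumes "\<phi> \<in> locally_finite_measures"
  shows "translate \<phi> 0 = \<phi>"
  unfolding translate_def using distr_id2[OF lfm_sets[OF assms, symmetric]] by simp

text \<open>Along a convergent, hence bounded, sequence of shifts all supports lie in one ball, and
  a multiple of its indicator dominates.\<close>

lemma integral_shift_continuous:
  fixes f :: "'a::euclidean_space \<Rightarrow> real"
  assumes \<phi>: "\<phi> \<in> locally_finite_measures" and f: "f \<in> Cc"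
  shows "continuous_on UNIV (\<lambda>y. \<integral>x. f (x - y) \<partial>\<phi>)"
  unfolding continuous_on_sequentially
proof (intro allI ballI impI)
  fix y :: "nat \<Rightarrow> 'a" and a assume "(\<forall>n. y n \<in> UNIV) \<and> y \<longlonglongrightarrow> a"
  then have lim: "y \<longlonglongrightarrow> a" by simp
  then obtain B where B: "\<And>n. norm (y n) \<le> B"
    using Bseq_def convergentI convergent_imp_Bseq by metis
  obtain m C where mC: "m > 0" "C > 0" "\<And>x. norm x > m \<Longrightarrow> f x = 0" "\<And>x. \<bar>f x\<bar> \<le> C"
    using Cc_bounded[OF f] by metis
  have shift: "(\<lambda>x. f (x - t)) \<in> borel_measurable \<phi>" for t
    using Cc_borel[OF Cc_shift[OF f, of "- t"]] lfm_borel_measurableI[OF \<phi>] by simp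
  have cont: "isCont f x" for x
    using f by (simp add: Cc_def continuous_on_eq_continuous_at)
  have "(\<lambda>n. \<integral>x. f (x - y n) \<partial>\<phi>) \<longlonglongrightarrow> (\<integral>x. f (x - a) \<partial>\<phi>)"
  proof (rule integral_dominated_convergence[where w = "\<lambda>x. C * indicat_real (cball 0 (m + B)) x"])
    show "integrable \<phi> (\<lambda>x. C * indicat_real (cball 0 (m + B)) x)"
      by (intro integrable_mult_right lfm_integrable_indicator[OF \<phi>]) auto
    show "AE x in \<phi>. (\<lambda>n. f (x - y n)) \<longlonglongrightarrow> f (x - a)"
      by (intro AE_I2 isCont_tendsto_compose[OF cont] tendsto_intros lim)
    show "AE x in \<phi>. norm (f (x - y n)) \<le> C * indicat_real (cball 0 (m + B)) x" for n
    proof (rule AE_I2)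
      fix x
      show "norm (f (x - y n)) \<le> C * indicat_real (cball 0 (m + B)) x"
      proof (cases "norm x \<le> m + B")
        case False
        then have "norm (x - y n) > m"
          using B[of n] norm_triangle_ineq2[of x "y n"] by linarith
        then show ?thesis using mC by simp
      qed (use mC(4) in simp)
    qed
  qed (use shift in auto)
  then show "((\<lambda>y. \<integral>x. f (x - y) \<partial>\<phi>) \<circ> y) \<longlonglongrightarrow> (\<integral>x. f (x - a) \<partial>\<phi>)"
    by (simp add: o_def)
qed

section \<open>Pairs of measures and their profiles\<close>

abbreviation lfm_pair :: "('a::euclidean_space measure \<times> 'a measure) set" where
  "lfm_pair \<equiv> locally_finite_measures \<times> locally_finite_measures"

definition translate_pair ::
    "'a::euclidean_space measure \<times> 'a measure \<Rightarrow> 'a \<Rightarrow> 'a measure \<times> 'a measure" where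
  "translate_pair p t = (translate (fst p) t, translate (snd p) t)"

lemma translate_pair_lfm: "p \<in> lfm_pair \<Longrightarrow> translate_pair p t \<in> lfm_pair"
  by (auto simp: translate_pair_def translate_lfm)

type_synonym profile_code = "bool \<times> tent_code list"

text \<open>The Boolean selects a component of the pair. The test function is recentred at
  \<open>y\<close>, so the value describes the pair as seen from \<open>y\<close> and moves along
  with translations.\<close>

definition profile :: "profile_code \<Rightarrow> 'a::euclidean_space measure \<times> 'a measure \<Rightarrow> 'a \<Rightarrow> real" where
  "profile i p y = (\<integral>x. tent_sup (snd i) (x - y) \<partial>(if fst i then fst p else snd p))"

lemma profile_continuous: "p \<in> lfm_pair \<Longrightarrow> continuous_on UNIV (profile i p)"
  unfolding profile_def by (intro integral_shift_continuous tent_sup_Cc) auto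

lemma profile_translate:
  assumes "p \<in> lfm_pair"
  shows "profile i (translate_pair p t) y = profile i p (y - t)"
proof -
  have "(\<lambda>x::'a. tent_sup K (x - y)) \<in> borel_measurable borel" for K
    using Cc_borel[OF Cc_shift[OF tent_sup_Cc, of K "- y"]] by simp
  then have "(\<integral>x. tent_sup K (x - y) \<partial>translate \<phi> t) = (\<integral>x. tent_sup K (x - (y - t)) \<partial>\<phi>)"
    if "\<phi> \<in> locally_finite_measures" for K and \<phi> :: "'a measure"
    using that by (subst integral_translate) (auto simp: algebra_simps)
  then show ?thesis
    using assms by (auto simp: profile_def translate_pair_def)
qed

lemma profile_measurable [measurable]:
  "(\<lambda>p. profile i p y) \<in> borel_measurable (vague_borel \<Otimes>\<^sub>M vague_borel)"
proof -
  have [measurable]: "(\<lambda>\<mu>. \<integral>x. tent_sup K (x - y) \<partial>\<mu>) \<in> borel_measurable vague_borel" for K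
    using vague_integral_measurable[OF Cc_shift[OF tent_sup_Cc, of K "- y"]] by simp
  show ?thesis
    by (cases "fst i") (auto simp: profile_def)
qed

text \<open>The profiles at the origin are exactly the \<open>tent_sup\<close> integrals of both
  components, to which \<open>lfm_eqI\<close> applies.\<close>

lemma pair_eqI:
  assumes "p \<in> lfm_pair" "q \<in> lfm_pair" "\<And>i. profile i p 0 = profile i q 0"
  shows "p = q"
proof (rule prod_eqI)
  show "fst p = fst q"
    using assms(1,2) assms(3)[of "(True, _)"] by (intro lfm_eqI) (auto simp: profile_def)
  show "snd p = snd q"
    using assms(1,2) assms(3)[of "(False, _)"] by (intro lfm_eqI) (auto simp: profile_def)
qed

text \<open>An l1 distance between finitely many profiles at \<open>y\<close> and their targets.
  Rational targets leave only countably many lists.\<close>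

definition discrepancy ::
    "(profile_code \<times> rat) list \<Rightarrow> 'a::euclidean_space measure \<times> 'a measure \<Rightarrow> 'a \<Rightarrow> real" where
  "discrepancy L p y = (\<Sum>(i, c)\<leftarrow>L. \<bar>profile i p y - of_rat c\<bar>)"

lemma discrepancy_Nil [simp]: "discrepancy [] p y = 0"
  and discrepancy_Cons [simp]:
    "discrepancy ((i, c) # L) p y = \<bar>profile i p y - of_rat c\<bar> + discrepancy L p y"
  by (auto simp: discrepancy_def)

lemma discrepancy_continuous:
  assumes "p \<in> lfm_pair"
  shows "continuous_on UNIV (discrepancy L p)"
proof (induction L)
  case Nil
  then show ?case by (simp add: discrepancy_def)
next
  case (Cons z L)
  obtain i c where z: "z = (i, c)" by (cases z)
  have "discrepancy (z # L) p = (\<lambda>y. \<bar>profile i p y - of_rat c\<bar> + discrepancy L p y)"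
    by (auto simp: z)
  then show ?case
    using Cons profile_continuous[OF assms, of i] by (auto intro!: continuous_intros)
qed

lemma discrepancy_translate:
  "p \<in> lfm_pair \<Longrightarrow> discrepancy L (translate_pair p t) y = discrepancy L p (y - t)"
  by (induction L) (auto simp: profile_translate)

lemma discrepancy_measurable [measurable]:
  "(\<lambda>p. discrepancy L p y) \<in> borel_measurable (vague_borel \<Otimes>\<^sub>M vague_borel)"
proof (induction L)
  case Nil
  then show ?case by simp
next
  case (Cons z L)
  obtain i c where z: "z = (i, c)" by (cases z)
  show ?case using Cons by (simp add: z)
qed

section \<open>Separated clusters\<close>

text \<open>The corner of a cluster of diameter at most \<open>r\<close> is within \<open>d * r\<close> of it, so clusters at
  distance \<open>(2 * d + 2) * r\<close> have corners at distance at least \<open>2 * r\<close>.\<close>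

definition sep :: "'a::euclidean_space itself \<Rightarrow> real" where
  "sep _ = 2 * DIM('a) + 2"

lemma sep_ge: "sep TYPE('a::euclidean_space) \<ge> 4"
  using DIM_positive[where 'a='a] by (simp add: sep_def)

definition separated :: "real \<Rightarrow> 'a::euclidean_space set \<Rightarrow> bool" where
  "separated r A \<longleftrightarrow> (\<forall>x\<in>A. \<forall>y\<in>A. dist x y \<le> r \<or> sep TYPE('a) * r \<le> dist x y)"

lemma separatedD:
  fixes A :: "'a::euclidean_space set"
  assumes "separated r A" "x \<in> A" "y \<in> A" "dist x y < sep TYPE('a) * r"
  shows "dist x y \<le> r"
  using assms unfolding separated_def by (meson linorder_not_le)

lemma sep_mult_ge: "r > 0 \<Longrightarrow> 4 * r \<le> sep TYPE('a::euclidean_space) * r"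
  using sep_ge[where 'a = 'a] by simp

text \<open>The slack \<open>1 / (n + 1)\<close> makes this set open, so that countably many points detect it.\<close>

definition valleys :: "real \<Rightarrow> real \<Rightarrow> ('a::euclidean_space \<Rightarrow> real) \<Rightarrow> 'a set" where
  "valleys d r G = {x. G x < d \<and> (\<exists>n. \<forall>y. r < norm y \<and> norm y < sep TYPE('a) * r \<longrightarrow>
     d + 1 / real (Suc n) \<le> G (x + y))}"

text \<open>If two points were at a forbidden distance, the annulus condition at one would make
  \<open>G\<close> larger than \<open>d\<close> at the other.\<close>

lemma separated_valleys: "separated r (valleys d r G :: 'a::euclidean_space set)"
  unfolding separated_def
proof (intro ballI)
  fix x y assume x: "x \<in> valleys d r G" and y: "y \<in> valleys d r (G :: 'a \<Rightarrow> real)"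
  show "dist x y \<le> r \<or> sep TYPE('a) * r \<le> dist x y"
  proof (rule ccontr)
    assume "\<not> ?thesis"
    then have "r < norm (y - x)" "norm (y - x) < sep TYPE('a) * r"
      by (auto simp: dist_norm norm_minus_commute)
    moreover obtain n where "\<forall>y. r < norm y \<and> norm y < sep TYPE('a) * r \<longrightarrow>
        d + 1 / real (Suc n) \<le> G (x + y)"
      using x by (auto simp: valleys_def)
    ultimately have "d + 1 / real (Suc n) \<le> G (x + (y - x))" by blast
    moreover have "0 < 1 / real (Suc n)" by simp
    moreover have "G (x + (y - x)) < d" using y by (simp add: valleys_def)
    ultimately show False by linarith
  qed
qed

text \<open>Under a small move of the centre, uniform continuity changes the values on the annulus
  by less than half of the slack; the other half remains.\<close>

lemma open_valleys:
  fixes G :: "'a::euclidean_space \<Rightarrow> real"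
  assumes "continuous_on UNIV G"
  shows "open (valleys d r G)"
  unfolding open_dist
proof
  fix x assume x: "x \<in> valleys d r G"
  let ?R = "sep TYPE('a) * r"
  obtain n where n: "\<And>y. r < norm y \<Longrightarrow> norm y < ?R \<Longrightarrow> d + 1 / real (Suc n) \<le> G (x + y)"
    using x by (auto simp: valleys_def)
  \<comment> \<open>The ball of radius \<open>?R + 1\<close> contains the annuli around all centres
    within distance 1 of \<open>x\<close>. The index \<open>2 * n + 1\<close> used next gives
    exactly half of \<open>1 / (n + 1)\<close>.\<close>
  have "uniformly_continuous_on (cball x (?R + 1)) G"
    by (intro compact_uniformly_continuous continuous_on_subset[OF assms]) auto
  moreover have "0 < 1 / real (Suc (2 * n + 1))" by simp
  ultimately obtain e where e: "e > 0"
      "\<And>u v. u \<in> cball x (?R + 1) \<Longrightarrow> v \<in> cball x (?R + 1) \<Longrightarrow> dist v u < e \<Longrightarrow>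
        dist (G v) (G u) < 1 / real (Suc (2 * n + 1))"
    unfolding uniformly_continuous_on_def by blast
  have "open (G -` {..<d})" by (rule open_vimage[OF open_lessThan assms])
  moreover have "x \<in> G -` {..<d}" using x by (simp add: valleys_def)
  ultimately obtain e' where e': "e' > 0" "\<And>y. dist y x < e' \<Longrightarrow> G y < d"
    unfolding open_dist by blast
  have "y \<in> valleys d r G" if y: "dist y x < min (min e e') 1" for y
  proof -
    have "d + 1 / real (Suc (2 * n + 1)) \<le> G (y + z)" if z: "r < norm z" "norm z < ?R" for z
    proof -
      have "dist x (y + z) \<le> dist y x + norm z"
        using norm_triangle_ineq[of "y - x" z] by (simp add: dist_norm norm_minus_commute algebra_simps)
      then have "dist (G (y + z)) (G (x + z)) < 1 / real (Suc (2 * n + 1))"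
        using y z by (intro e(2)) (auto simp: dist_norm)
      then have "G (x + z) - G (y + z) < 1 / real (Suc (2 * n + 1))"
        by (simp add: dist_real_def)
      moreover have "1 / real (Suc n) = 1 / real (Suc (2 * n + 1)) + 1 / real (Suc (2 * n + 1))"
        by (simp add: field_simps)
      ultimately show ?thesis using n[OF z] by linarith
    qed
    moreover have "G y < d" using e'(2)[of y] y by simp
    ultimately show ?thesis unfolding valleys_def by blast
  qed
  then show "\<exists>e>0. \<forall>y. dist y x < e \<longrightarrow> y \<in> valleys d r G"
    using e(1) e'(1) by (intro exI[of _ "min (min e e') 1"]) auto
qed

text \<open>Violations of the lower bound within the annulus form an open set, thanks to the strict
  inequalities bounding the annulus, so some \<open>dense_seq k\<close> detects them. This makes
  membership a countable condition.\<close>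

lemma valleys_dense_seq:
  fixes G :: "'a::euclidean_space \<Rightarrow> real"
  assumes "continuous_on UNIV G"
  shows "x \<in> valleys d r G \<longleftrightarrow> G x < d \<and>
    (\<exists>n. \<forall>k. r < norm (dense_seq k :: 'a) \<and> norm (dense_seq k :: 'a) < sep TYPE('a) * r \<longrightarrow>
      d + 1 / real (Suc n) \<le> G (x + dense_seq k))"
proof -
  have "(\<forall>y. r < norm y \<and> norm y < R \<longrightarrow> c \<le> G (x + y)) \<longleftrightarrow>
      (\<forall>k. r < norm (dense_seq k :: 'a) \<and> norm (dense_seq k :: 'a) < R \<longrightarrow> c \<le> G (x + dense_seq k))"
    for c R
  proof (intro iffI allI impI; clarsimp?)
    fix y :: 'a assume *: "\<forall>k. r < norm (dense_seq k :: 'a) \<and> norm (dense_seq k :: 'a) < R \<longrightarrow> c \<le> G (x + dense_seq k)"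
      and y: "r < norm y" "norm y < R"
    show "c \<le> G (x + y)"
    proof (rule ccontr)
      assume "\<not> c \<le> G (x + y)"
      moreover have "open {y. r < norm y \<and> norm y < R \<and> G (x + y) < c}"
        by (intro open_Collect_conj open_Collect_less continuous_intros
            continuous_on_compose2[OF assms]) auto
      ultimately obtain k where "dense_seq k \<in> {y. r < norm y \<and> norm y < R \<and> G (x + y) < c}"
        using dense_seq[of "{y. r < norm y \<and> norm y < R \<and> G (x + y) < c}" y] y by (auto simp: not_le)
      then show False using * by auto
    qed
  qed
  then show ?thesis unfolding valleys_def by simp
qed

lemma valleys_translate: "valleys d r (\<lambda>y. G (y - t)) = (\<lambda>x. x + t) ` valleys d r G"
proof -
  have "x \<in> valleys d r (\<lambda>y. G (y - t)) \<longleftrightarrow> x - t \<in> valleys d r G" for x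
    by (simp add: valleys_def algebra_simps)
  moreover have "x \<in> (\<lambda>x. x + t) ` valleys d r G \<longleftrightarrow> x - t \<in> valleys d r G" for x
    by (auto intro: image_eqI[where x = "x - t"])
  ultimately show ?thesis by blast
qed

section \<open>Corners of clusters\<close>

text \<open>For separated \<open>A\<close> and \<open>x\<close> in \<open>A\<close>, the ball of
  radius \<open>2 * r\<close> catches exactly the cluster of \<open>x\<close>, and the result is the
  lower corner of the bounding box of that cluster. It need not belong to \<open>A\<close>.\<close>

definition corner :: "real \<Rightarrow> 'a::euclidean_space set \<Rightarrow> 'a \<Rightarrow> 'a" where
  "corner r A x = (\<Sum>i\<in>Basis. (INF z \<in> A \<inter> ball x (2 * r). z \<bullet> i) *\<^sub>R i)"

text \<open>On \<open>A\<close>, being closer than \<open>sep * r\<close> already means being within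
  \<open>r\<close>; since \<open>2 * r < sep * r\<close>, this relation is transitive.\<close>

lemma cluster_eq:
  fixes A :: "'a::euclidean_space set"
  assumes A: "separated r A" "r > 0" and x: "x \<in> A" "y \<in> A" "dist x y < sep TYPE('a) * r"
  shows "A \<inter> ball x (2 * r) = A \<inter> ball y (2 * r)"
proof -
  note s = sep_mult_ge[OF A(2), where 'a = 'a]
  have "z \<in> ball v (2 * r)"
    if z: "z \<in> A" "z \<in> ball u (2 * r)" and uv: "u \<in> A" "v \<in> A" "dist u v < sep TYPE('a) * r" for u v z
  proof -
    have "dist u z < sep TYPE('a) * r" using z(2) s A(2) unfolding mem_ball by linarith
    then have "dist u z \<le> r" by (rule separatedD[OF A(1) uv(1) z(1)])
    moreover have "dist u v \<le> r" by (rule separatedD[OF A(1) uv])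
    ultimately have "dist v z < sep TYPE('a) * r"
      using dist_triangle3[of v z u] s A(2) by linarith
    then have "dist v z \<le> r" by (rule separatedD[OF A(1) uv(2) z(1)])
    then show ?thesis using A(2) by simp
  qed
  then show ?thesis using x by (auto simp: dist_commute)
qed

lemma corner_eq:
  fixes A :: "'a::euclidean_space set"
  assumes "separated r A" "r > 0" "x \<in> A" "y \<in> A" "dist x y < sep TYPE('a) * r"
  shows "corner r A x = corner r A y"
  unfolding corner_def cluster_eq[OF assms] ..

lemma corner_inner: "i \<in> Basis \<Longrightarrow> corner r A x \<bullet> i = (INF z \<in> A \<inter> ball x (2 * r). z \<bullet> i)"
  by (simp add: corner_def)

lemma ball_inner_ge:
  assumes "i \<in> Basis" "z \<in> ball x s"
  shows "x \<bullet> i - s \<le> z \<bullet> i"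
  using Basis_le_norm[OF assms(1), of "x - z"] assms(2) by (simp add: dist_norm inner_diff_left)

text \<open>The infimum is over a nonempty set bounded below. Replacing it by an existence statement
  serves both measurability and equivariance.\<close>

lemma corner_less:
  assumes "x \<in> A" "r > 0" "i \<in> Basis"
  shows "corner r A x \<bullet> i < a \<longleftrightarrow> (\<exists>z \<in> A \<inter> ball x (2 * r). z \<bullet> i < a)"
proof -
  have "bdd_below ((\<lambda>z. z \<bullet> i) ` (A \<inter> ball x (2 * r)))"
    using ball_inner_ge[OF assms(3)] by (intro bdd_belowI2[of _ "x \<bullet> i - 2 * r"]) auto
  moreover have "A \<inter> ball x (2 * r) \<noteq> {}" using assms by auto
  ultimately show ?thesis
    unfolding corner_inner[OF assms(3)] by (subst cINF_less_iff) auto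
qed

text \<open>All points of the cluster are within \<open>r\<close> of \<open>x\<close>, so each
  coordinate of the corner falls short of that of \<open>x\<close> by at most \<open>r\<close>; the
  norm is bounded by the sum of the coordinates' absolute values.\<close>

lemma corner_near:
  fixes A :: "'a::euclidean_space set"
  assumes A: "separated r A" "r > 0" and x: "x \<in> A"
  shows "dist (corner r A x) x \<le> real DIM('a) * r"
proof -
  have "\<bar>(corner r A x - x) \<bullet> i\<bar> \<le> r" if i: "i \<in> Basis" for i
  proof -
    have "corner r A x \<bullet> i \<le> x \<bullet> i"
    proof (rule dense_ge)
      fix b assume "x \<bullet> i < b"
      then have "\<exists>z \<in> A \<inter> ball x (2 * r). z \<bullet> i < b"
        using x A(2) by (intro bexI[of _ x]) auto
      then have "corner r A x \<bullet> i < b" unfolding corner_less[OF x A(2) i] .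
      then show "corner r A x \<bullet> i \<le> b" by simp
    qed
    moreover have "x \<bullet> i - r \<le> corner r A x \<bullet> i"
    proof (rule ccontr)
      assume "\<not> ?thesis"
      then obtain z where z: "z \<in> A" "z \<in> ball x (2 * r)" "z \<bullet> i < x \<bullet> i - r"
        using corner_less[OF x A(2) i] by (auto simp: not_le)
      have "dist x z < sep TYPE('a) * r"
        using z(2) sep_mult_ge[OF A(2), where 'a = 'a] A(2) unfolding mem_ball by linarith
      then have "dist x z \<le> r" by (rule separatedD[OF A(1) x z(1)])
      then show False
        using Basis_le_norm[OF i, of "x - z"] z(3) by (simp add: dist_norm inner_diff_left)
    qed
    ultimately show ?thesis by (simp add: inner_diff_left)
  qed
  then have "norm (corner r A x - x) \<le> (\<Sum>i\<in>(Basis::'a set). r)"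
    by (intro order_trans[OF norm_le_l1] sum_mono)
  then show ?thesis by (simp add: dist_norm)
qed

text \<open>By \<open>corner_near\<close>, corners closer than \<open>r\<close> come from points
  closer than \<open>sep * r\<close>, hence from a single cluster, which has one corner.\<close>

lemma uniform_discrete_corners:
  fixes A :: "'a::euclidean_space set"
  assumes A: "separated r A" "r > 0"
  shows "uniform_discrete (corner r A ` A)"
  unfolding uniform_discrete_def
proof (intro exI[of _ r] conjI ballI impI; clarify?)
  fix x y assume xy: "x \<in> A" "y \<in> A" "dist (corner r A x) (corner r A y) < r"
  have "dist x y \<le> dist (corner r A x) x + dist (corner r A x) (corner r A y) + dist (corner r A y) y"
    using dist_triangle3[of x y "corner r A x"] dist_triangle[of "corner r A x" y "corner r A y"]
    by linarith
  also have "\<dots> < 2 * (real DIM('a) * r) + 2 * r"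
    using corner_near[OF A xy(1)] corner_near[OF A xy(2)] xy(3) A(2) by linarith
  also have "\<dots> = sep TYPE('a) * r" by (simp add: sep_def algebra_simps)
  finally show "corner r A x = corner r A y"
    using corner_eq[OF A] xy by blast
qed (use A in simp)

lemma uniform_discrete_locally_finite: "uniform_discrete S \<Longrightarrow> locally_finite_set S"
  unfolding locally_finite_set_def
  by (auto intro!: uniform_discrete_finite_iff[THEN iffD1] uniform_discrete_subset[of S]
      bounded_subset[OF compact_imp_bounded])

text \<open>Coordinates are compared through \<open>corner_less\<close>: real numbers with the same
  strict upper bounds coincide.\<close>

lemma corner_translate:
  assumes "r > 0" "x \<in> A"
  shows "corner r ((\<lambda>x. x + t) ` A) (x + t) = corner r A x + t"
proof (rule euclidean_eqI)
  fix i :: 'a assume i: "i \<in> Basis"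
  have "corner r ((\<lambda>x. x + t) ` A) (x + t) \<bullet> i < a \<longleftrightarrow> (corner r A x + t) \<bullet> i < a" for a
  proof -
    have "corner r ((\<lambda>x. x + t) ` A) (x + t) \<bullet> i < a \<longleftrightarrow>
        (\<exists>z \<in> (\<lambda>x. x + t) ` A \<inter> ball (x + t) (2 * r). z \<bullet> i < a)"
      using assms i by (intro corner_less) auto
    also have "(\<lambda>x. x + t) ` A \<inter> ball (x + t) (2 * r) = (\<lambda>x. x + t) ` (A \<inter> ball x (2 * r))"
      by auto
    also have "(\<exists>z \<in> (\<lambda>x. x + t) ` (A \<inter> ball x (2 * r)). z \<bullet> i < a) \<longleftrightarrow>
        (\<exists>z \<in> A \<inter> ball x (2 * r). z \<bullet> i < a - t \<bullet> i)"
      unfolding Set.bex_simps(7) by (simp add: inner_add_left less_diff_eq)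
    also have "\<dots> \<longleftrightarrow> corner r A x \<bullet> i < a - t \<bullet> i"
      using assms i by (intro corner_less[symmetric]) auto
    finally show ?thesis by (simp add: inner_add_left less_diff_eq)
  qed
  then show "corner r ((\<lambda>x. x + t) ` A) (x + t) \<bullet> i = (corner r A x + t) \<bullet> i"
    by (meson less_irrefl linorder_neq_iff)
qed

section \<open>The point process\<close>

text \<open>The list of profiles with targets, the index of the threshold and the index of the
  radius; an index \<open>n\<close> stands for the value \<open>1 / (n + 1)\<close>. The type is
  countable.\<close>

type_synonym site_code = "(profile_code \<times> rat) list \<times> nat \<times> nat"

definition radius :: "site_code \<Rightarrow> real" where
  "radius \<theta> = 1 / real (Suc (snd (snd \<theta>)))"

lemma radius_pos: "radius \<theta> > 0"
  by (simp add: radius_def)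

definition sites :: "site_code \<Rightarrow> 'a::euclidean_space measure \<times> 'a measure \<Rightarrow> 'a set" where
  "sites \<theta> p = valleys (1 / real (Suc (fst (snd \<theta>)))) (radius \<theta>) (discrepancy (fst \<theta>) p)"

definition points :: "site_code \<Rightarrow> 'a::euclidean_space measure \<times> 'a measure \<Rightarrow> 'a set" where
  "points \<theta> p = corner (radius \<theta>) (sites \<theta> p) ` sites \<theta> p"

lemma separated_sites: "separated (radius \<theta>) (sites \<theta> p)"
  unfolding sites_def by (rule separated_valleys)

lemma open_sites: "p \<in> lfm_pair \<Longrightarrow> open (sites \<theta> p)"
  unfolding sites_def by (intro open_valleys discrepancy_continuous)

lemma locally_finite_points: "locally_finite_set (points \<theta> p)"
  unfolding points_def
  by (intro uniform_discrete_locally_finite uniform_discrete_corners separated_sites radius_pos)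

lemma sites_translate:
  assumes "p \<in> lfm_pair"
  shows "sites \<theta> (translate_pair p t) = (\<lambda>x. x + t) ` sites \<theta> p"
proof -
  have "discrepancy L (translate_pair p t) = (\<lambda>y. discrepancy L p (y - t))" for L
    using discrepancy_translate[OF assms] by blast
  then show ?thesis
    by (simp add: sites_def valleys_translate)
qed

lemma points_translate:
  assumes "p \<in> lfm_pair"
  shows "points \<theta> (translate_pair p t) = (\<lambda>x. x + t) ` points \<theta> p"
  unfolding points_def sites_translate[OF assms] image_image
  by (intro image_cong refl corner_translate radius_pos)

section \<open>Counting measures of point sets\<close>

lemma counting_measure_lfm:
  assumes "locally_finite_set S"
  shows "counting_measure S \<in> locally_finite_measures"
proof -
  have "emeasure (counting_measure S) K < \<infinity>" if "compact K" for K
    using assms that by (subst emeasure_counting_measure)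
      (auto simp: locally_finite_set_def borel_compact Int_commute of_nat_less_top)
  then show ?thesis
    by (simp add: locally_finite_measures_def counting_measure_def)
qed

lemma counting_measure_translate:
  "translate (counting_measure S) t = counting_measure ((\<lambda>x. x + t) ` S)"
proof -
  have "bij_betw (\<lambda>x. x + t) S ((\<lambda>x. x + t) ` S)"
    by (simp add: bij_betw_def)
  then have "counting_measure ((\<lambda>x. x + t) ` S) =
      distr (distr (count_space S) (count_space ((\<lambda>x. x + t) ` S)) (\<lambda>x. x + t)) borel (\<lambda>x. x)"
    by (simp add: counting_measure_def distr_bij_count_space)
  also have "\<dots> = distr (count_space S) borel (\<lambda>x. x + t)"
    by (subst distr_distr) (auto simp: o_def)
  also have "\<dots> = translate (counting_measure S) t"
    unfolding translate_def counting_measure_def by (subst distr_distr) (auto simp: o_def)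
  finally show ?thesis ..
qed

text \<open>The enumeration may repeat points; keeping only the first index of each point gives a
  bijection with \<open>S\<close>. The integral becomes a series whose terms can be checked for
  measurability one by one.\<close>

lemma nn_integral_counting_measure_enum:
  fixes c :: "nat \<Rightarrow> 'a::euclidean_space"
  assumes h: "h \<in> borel_measurable borel" and S: "S = {c j | j. Q j}"
  shows "(\<integral>\<^sup>+x. h x \<partial>counting_measure S) =
    (\<Sum>j. h (c j) * indicator {j. Q j \<and> (\<forall>k<j. Q k \<longrightarrow> c k \<noteq> c j)} j)"
proof -
  let ?J = "{j. Q j \<and> (\<forall>k<j. Q k \<longrightarrow> c k \<noteq> c j)}"
  have inj: "inj_on c ?J"
  proof (rule inj_onI)
    fix i j assume "i \<in> ?J" "j \<in> ?J" "c i = c j"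
    then show "i = j" by (cases i j rule: linorder_cases) auto
  qed
  have "s \<in> c ` ?J" if "s \<in> S" for s
  proof -
    have ex: "\<exists>j. Q j \<and> c j = s" using that S by auto
    then obtain j where "Q j \<and> c j = s" "\<forall>k<j. \<not> (Q k \<and> c k = s)"
      using exists_least_iff[of "\<lambda>j. Q j \<and> c j = s"] by blast
    then show ?thesis by blast
  qed
  then have bij: "bij_betw c ?J S"
    using inj S by (auto simp: bij_betw_def)
  have "(\<integral>\<^sup>+x. h x \<partial>counting_measure S) = (\<integral>\<^sup>+x. h x \<partial>count_space S)"
    unfolding counting_measure_def using h by (subst nn_integral_distr) auto
  also have "\<dots> = (\<integral>\<^sup>+j. h (c j) \<partial>count_space ?J)"
    by (rule nn_integral_bij_count_space[OF bij, symmetric])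
  also have "\<dots> = (\<integral>\<^sup>+j. h (c j) * indicator ?J j \<partial>count_space UNIV)"
    by (subst nn_integral_count_space_indicator) auto
  finally show ?thesis by (simp add: nn_integral_count_space_nat)
qed

section \<open>Measurable dependence on the pair of measures\<close>

abbreviation pair_borel :: "('a::euclidean_space measure \<times> 'a measure) measure" where
  "pair_borel \<equiv> vague_borel \<Otimes>\<^sub>M vague_borel"

lemma space_pair_borel: "space pair_borel = lfm_pair"
  by (simp add: space_pair_measure)

lemma sites_measurable [measurable]: "Measurable.pred pair_borel (\<lambda>p. x \<in> sites \<theta> p)"
proof -
  let ?d = "1 / real (Suc (fst (snd \<theta>)))" and ?G = "discrepancy (fst \<theta>)"
  have "Measurable.pred pair_borel (\<lambda>p. ?G p x < ?d \<and>
    (\<exists>n. \<forall>k. radius \<theta> < norm (dense_seq k :: 'a) \<and>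
      norm (dense_seq k :: 'a) < sep TYPE('a) * radius \<theta> \<longrightarrow>
      ?d + 1 / real (Suc n) \<le> ?G p (x + dense_seq k)))" (is "Measurable.pred _ ?P")
    by measurable
  moreover have "x \<in> sites \<theta> p \<longleftrightarrow> ?P p" if "p \<in> space pair_borel" for p
    unfolding sites_def
    by (rule valleys_dense_seq[OF discrepancy_continuous]) (use that space_pair_borel in blast)
  ultimately show ?thesis
    by (rule measurable_cong[THEN iffD2, rotated])
qed

text \<open>The default 0 makes the function total; \<open>points_eq_nth_point\<close> only collects
  indices \<open>j\<close> for which \<open>dense_seq j\<close> is a site.\<close>

definition nth_point :: "site_code \<Rightarrow> nat \<Rightarrow> 'a::euclidean_space measure \<times> 'a measure \<Rightarrow> 'a" where
  "nth_point \<theta> j p =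
    (if dense_seq j \<in> sites \<theta> p then corner (radius \<theta>) (sites \<theta> p) (dense_seq j) else 0)"

text \<open>The set of sites is open, so every cluster contains some \<open>dense_seq j\<close>, and
  all members of a cluster share their corner.\<close>

lemma points_eq_nth_point:
  assumes "p \<in> lfm_pair"
  shows "points \<theta> p = {nth_point \<theta> j p | j. dense_seq j \<in> sites \<theta> p}"
proof -
  have "\<exists>j. dense_seq j \<in> sites \<theta> p \<and>
      corner (radius \<theta>) (sites \<theta> p) x = corner (radius \<theta>) (sites \<theta> p) (dense_seq j)"
    if x: "x \<in> sites \<theta> p" for x
  proof -
    have "open (sites \<theta> p \<inter> ball x (radius \<theta>))" "x \<in> sites \<theta> p \<inter> ball x (radius \<theta>)"
      using open_sites[OF assms, of \<theta>] x radius_pos[of \<theta>] by auto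
    then obtain j where j: "dense_seq j \<in> sites \<theta> p \<inter> ball x (radius \<theta>)"
      by (rule dense_seq)
    have "dist x (dense_seq j) < sep TYPE('a) * radius \<theta>"
      using j sep_mult_ge[OF radius_pos[of \<theta>], where 'a = 'a] radius_pos[of \<theta>]
      unfolding Int_iff mem_ball by linarith
    then show ?thesis
      using j corner_eq[OF separated_sites radius_pos x] by blast
  qed
  then show ?thesis
    unfolding points_def nth_point_def by fastforce
qed

lemma nth_point_measurable [measurable]: "nth_point \<theta> j \<in> borel_measurable pair_borel"
proof (subst borel_measurable_euclidean_space, intro ballI borel_measurableI_less)
  fix i :: 'a and a :: real assume i: "i \<in> Basis"
  let ?e = "dense_seq :: nat \<Rightarrow> 'a"
  have "nth_point \<theta> j p \<bullet> i < a \<longleftrightarrow> (if ?e j \<in> sites \<theta> p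
      then \<exists>k. ?e k \<in> sites \<theta> p \<and> ?e k \<in> ball (?e j) (2 * radius \<theta>) \<and> ?e k \<bullet> i < a else 0 < a)"
    if "p \<in> space pair_borel" for p
  proof (cases "?e j \<in> sites \<theta> p")
    case True
    \<comment> \<open>Openness lets the witness provided by \<open>corner_less\<close> be replaced
      by some \<open>dense_seq k\<close>, which leaves a countable existential.\<close>
    have o: "open (sites \<theta> p \<inter> ball (?e j) (2 * radius \<theta>) \<inter> {z. z \<bullet> i < a})"
      using that space_pair_borel
      by (intro open_Int open_sites open_ball open_halfspace_component_lt) blast
    have "nth_point \<theta> j p \<bullet> i < a \<longleftrightarrow> (\<exists>z. z \<in> sites \<theta> p \<inter> ball (?e j) (2 * radius \<theta>) \<inter> {z. z \<bullet> i < a})"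
      using True corner_less[OF True radius_pos i] by (auto simp: nth_point_def)
    also have "\<dots> \<longleftrightarrow> (\<exists>k. ?e k \<in> sites \<theta> p \<inter> ball (?e j) (2 * radius \<theta>) \<inter> {z. z \<bullet> i < a})"
      using dense_seq[OF o] by blast
    finally show ?thesis using True by simp
  next
    case False
    then show ?thesis by (simp add: nth_point_def)
  qed
  then have "{p \<in> space pair_borel. nth_point \<theta> j p \<bullet> i < a} = {p \<in> space pair_borel. if ?e j \<in> sites \<theta> p
      then \<exists>k. ?e k \<in> sites \<theta> p \<and> ?e k \<in> ball (?e j) (2 * radius \<theta>) \<and> ?e k \<bullet> i < a else 0 < a}"
    by blast
  also have "\<dots> \<in> sets pair_borel"
    by measurable
  finally show "{p \<in> space pair_borel. nth_point \<theta> j p \<bullet> i < a} \<in> sets pair_borel" .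
qed

lemma points_nn_integral_measurable:
  fixes h :: "'a::euclidean_space \<Rightarrow> ennreal"
  assumes [measurable]: "h \<in> borel_measurable borel"
  shows "(\<lambda>p. \<integral>\<^sup>+x. h x \<partial>counting_measure (points \<theta> p)) \<in> borel_measurable pair_borel"
proof -
  let ?Q = "\<lambda>j p. (dense_seq j :: 'a) \<in> sites \<theta> p"
  have "(\<lambda>p. \<Sum>j. h (nth_point \<theta> j p) *
      indicator {p. ?Q j p \<and> (\<forall>k<j. ?Q k p \<longrightarrow> nth_point \<theta> k p \<noteq> nth_point \<theta> j p)} p)
      \<in> borel_measurable pair_borel"
    by measurable
  moreover have "(\<integral>\<^sup>+x. h x \<partial>counting_measure (points \<theta> p)) = (\<Sum>j. h (nth_point \<theta> j p) *
      indicator {p. ?Q j p \<and> (\<forall>k<j. ?Q k p \<longrightarrow> nth_point \<theta> k p \<noteq> nth_point \<theta> j p)} p)"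
    if "p \<in> space pair_borel" for p
    using that unfolding space_pair_borel
    by (subst nn_integral_counting_measure_enum[OF assms points_eq_nth_point]) (auto simp: indicator_def)
  ultimately show ?thesis
    by (rule measurable_cong[THEN iffD2, rotated])
qed

lemma points_integral_measurable:
  fixes f :: "'a::euclidean_space \<Rightarrow> real"
  assumes f: "f \<in> Cc"
  shows "(\<lambda>p. \<integral>x. f x \<partial>counting_measure (points \<theta> p)) \<in> borel_measurable pair_borel"
proof -
  have [measurable]: "f \<in> borel_measurable borel" by (rule Cc_borel[OF f])
  have [measurable]:
    "(\<lambda>p. \<integral>\<^sup>+x. ennreal (f x) \<partial>counting_measure (points \<theta> p)) \<in> borel_measurable pair_borel"
    "(\<lambda>p. \<integral>\<^sup>+x. ennreal (- f x) \<partial>counting_measure (points \<theta> p)) \<in> borel_measurable pair_borel"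
    by (rule points_nn_integral_measurable; measurable)+
  have "(\<integral>x. f x \<partial>counting_measure (points \<theta> p)) =
      enn2real (\<integral>\<^sup>+x. ennreal (f x) \<partial>counting_measure (points \<theta> p)) -
      enn2real (\<integral>\<^sup>+x. ennreal (- f x) \<partial>counting_measure (points \<theta> p))" for p
    by (intro real_lebesgue_integral_def Cc_integrable[OF f] counting_measure_lfm locally_finite_points)
  then show ?thesis by simp
qed

text \<open>If all site sets of \<open>p\<close> are empty, \<open>LEAST\<close> is unspecified, but then \<open>site_process p\<close> is the
  zero measure whatever its value.\<close>

definition first_code :: "'a::euclidean_space measure \<times> 'a measure \<Rightarrow> nat" where
  "first_code p = (LEAST n. sites (from_nat n) p \<noteq> {})"

definition site_process :: "'a::euclidean_space measure \<times> 'a measure \<Rightarrow> 'a measure" where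
  "site_process p = counting_measure (points (from_nat (first_code p)) p)"

text \<open>An open set is nonempty exactly when it contains some \<open>dense_seq k\<close>, so the
  least code is determined by countably many measurable predicates.\<close>

lemma first_code_measurable [measurable]: "first_code \<in> measurable pair_borel (count_space UNIV)"
proof -
  have "sites \<theta> p \<noteq> {} \<longleftrightarrow> (\<exists>k. (dense_seq k :: 'a) \<in> sites \<theta> p)" if "p \<in> space pair_borel" for \<theta> p
  proof -
    have "open (sites \<theta> p)" using that open_sites space_pair_borel by blast
    then show ?thesis by (metis dense_seq empty_iff ex_in_conv)
  qed
  then have "first_code p = (LEAST n. \<exists>k. (dense_seq k :: 'a) \<in> sites (from_nat n) p)"
    if "p \<in> space pair_borel" for p
    using that by (simp add: first_code_def)
  moreover have "(\<lambda>p. LEAST n. \<exists>k. (dense_seq k :: 'a) \<in> sites (from_nat n) p)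
      \<in> measurable pair_borel (count_space UNIV)"
    by measurable
  ultimately show ?thesis
    by (rule measurable_cong[THEN iffD2])
qed

lemma site_process_measurable: "site_process \<in> measurable pair_borel vague_borel"
proof (rule measurable_vague_borelI)
  fix f :: "'a \<Rightarrow> real" assume "f \<in> Cc"
  then have "(\<lambda>p. \<integral>x. f x \<partial>counting_measure (points \<theta> p)) \<in> borel_measurable pair_borel" for \<theta>
    by (rule points_integral_measurable)
  then show "(\<lambda>p. \<integral>x. f x \<partial>site_process p) \<in> borel_measurable pair_borel"
    unfolding site_process_def
    by (rule measurable_compose_countable[OF _ first_code_measurable])
qed (simp add: site_process_def counting_measure_lfm locally_finite_points)

text \<open>Translation moves every site set without changing whether it is empty, so the pair and
  its translate select the same code.\<close>

lemma site_process_translate: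
  assumes "p \<in> lfm_pair"
  shows "site_process (translate_pair p t) = translate (site_process p) t"
proof -
  have "first_code (translate_pair p t) = first_code p"
    by (simp add: first_code_def sites_translate[OF assms])
  then show ?thesis
    by (simp add: site_process_def points_translate[OF assms] counting_measure_translate)
qed

lemma site_process_nonempty:
  assumes "sites \<theta> p \<noteq> {}"
  shows "points (from_nat (first_code p)) p \<noteq> {}"
proof -
  have "sites (from_nat (first_code p)) p \<noteq> {}"
    unfolding first_code_def by (rule LeastI[of _ "to_nat \<theta>"]) (simp add: assms)
  then show ?thesis by (simp add: points_def)
qed

section \<open>Existence of sites\<close>

text \<open>If nonzero \<open>t n \<in> H\<close> tend to \<open>0\<close> and their directions to \<open>u\<close>, then \<open>l *\<^sub>R u\<close> is the limit
  of the multiples of \<open>t n\<close> by \<open>\<lfloor>l / norm (t n)\<rfloor>\<close>, so \<open>H\<close> contains a line.\<close>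

lemma closed_subgroup_discrete:
  fixes H :: "'a::euclidean_space set"
  assumes cl: "closed H" and zero: "0 \<in> H"
    and add: "\<And>s t. s \<in> H \<Longrightarrow> t \<in> H \<Longrightarrow> s + t \<in> H" and neg: "\<And>t. t \<in> H \<Longrightarrow> - t \<in> H"
    and noline: "\<And>t. t \<noteq> 0 \<Longrightarrow> \<exists>l. l *\<^sub>R t \<notin> H"
  obtains \<rho> where "\<rho> > 0" "\<And>t. t \<in> H \<Longrightarrow> t \<noteq> 0 \<Longrightarrow> \<rho> \<le> norm t"
proof -
  have nat_mult: "real n *\<^sub>R t \<in> H" if "t \<in> H" for n t
    by (induction n) (auto simp: zero scaleR_left_distrib intro: add that)
  have int_mult: "of_int k *\<^sub>R t \<in> H" if "t \<in> H" for k t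
    using nat_mult[OF that] neg by (cases k rule: int_cases2) fastforce+
  show ?thesis
  proof (rule ccontr)
    assume nt: "\<not> thesis"
    have "\<exists>t. t \<in> H \<and> t \<noteq> 0 \<and> norm t < 1 / real (Suc n)" for n
    proof (rule ccontr)
      assume "\<not> ?thesis"
      then have "\<And>t. t \<in> H \<Longrightarrow> t \<noteq> 0 \<Longrightarrow> 1 / real (Suc n) \<le> norm t"
        by (meson linorder_not_le)
      moreover have "0 < 1 / real (Suc n)" by simp
      ultimately have thesis by (rule that[rotated])
      then show False using nt by simp
    qed
    then obtain t where t: "\<And>n. t n \<in> H" "\<And>n. t n \<noteq> 0" "\<And>n. norm (t n) < 1 / real (Suc n)"
      by metis
    have nl: "(\<lambda>n. norm (t n)) \<longlonglongrightarrow> 0"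
      using t(3) by (intro tendsto_sandwich[OF _ _ tendsto_const LIMSEQ_inverse_real_of_nat])
        (auto intro!: always_eventually less_imp_le simp: inverse_eq_divide)
    have "\<forall>n. t n /\<^sub>R norm (t n) \<in> sphere 0 1"
      using t(2) by simp
    then obtain u s where u: "u \<in> sphere 0 1" and s: "strict_mono s"
        and lim: "((\<lambda>n. t n /\<^sub>R norm (t n)) \<circ> s) \<longlonglongrightarrow> u"
      by (rule seq_compactE[OF compact_imp_seq_compact[OF compact_sphere]])
    have norm_lim: "(\<lambda>n. norm (t (s n))) \<longlonglongrightarrow> 0"
      using LIMSEQ_subseq_LIMSEQ[OF nl s] by (simp add: o_def)
    have "l *\<^sub>R u \<in> H" for l
    proof -
      \<comment> \<open>The signed length of the integer multiple of \<open>t (s n)\<close> obtained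
        by rounding; it differs from \<open>l\<close> by at most \<open>norm (t (s n))\<close>,
        which tends to 0.\<close>
      let ?c = "\<lambda>n. of_int \<lfloor>l / norm (t (s n))\<rfloor> * norm (t (s n))"
      have "norm (?c n - l) \<le> norm (t (s n))" for n
      proof -
        have p: "norm (t (s n)) > 0" using t(2) by simp
        have "?c n \<le> l / norm (t (s n)) * norm (t (s n))"
          using p by (intro mult_right_mono) auto
        moreover have "(l / norm (t (s n)) - 1) * norm (t (s n)) \<le> ?c n"
          using p by (intro mult_right_mono) linarith+
        ultimately show ?thesis using p by (simp add: left_diff_distrib abs_le_iff)
      qed
      then have "(\<lambda>n. ?c n - l) \<longlonglongrightarrow> 0"
        by (intro Lim_null_comparison[OF _ norm_lim] always_eventually) blast
      then have c: "?c \<longlonglongrightarrow> l" by (rule LIM_zero_cancel)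
      have "(\<lambda>n. ?c n *\<^sub>R (t (s n) /\<^sub>R norm (t (s n)))) \<longlonglongrightarrow> l *\<^sub>R u"
        using c lim by (intro tendsto_scaleR) (auto simp: o_def)
      moreover have "?c n *\<^sub>R (t (s n) /\<^sub>R norm (t (s n))) \<in> H" for n
        using int_mult[OF t(1)[of "s n"]] t(2) by (simp add: mult.assoc)
      ultimately show ?thesis
        by (rule closed_sequentially[OF cl, rotated])
    qed
    moreover have "u \<noteq> 0" using u by auto
    ultimately show False using noline by blast
  qed
qed

text \<open>Translating by \<open>t\<close> and looking from the origin amounts to looking from
  \<open>- t\<close>. The stabilizer thus becomes a set defined by equations between continuous
  functions.\<close>

lemma translate_pair_fixed_iff:
  assumes "p \<in> lfm_pair"
  shows "translate_pair p t = p \<longleftrightarrow> (\<forall>i. profile i p (- t) = profile i p 0)"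
  using profile_translate[OF assms, of _ t 0] pair_eqI[OF translate_pair_lfm[OF assms] assms, of t]
  by auto

text \<open>The stabilizer is closed by continuity of the profiles, and a line in it would be an
  invariant direction, so \<open>closed_subgroup_discrete\<close> applies.\<close>

lemma stabilizer_discrete:
  fixes p :: "'a::euclidean_space measure \<times> 'a measure"
  assumes p: "p \<in> lfm_pair" and "\<nexists>t. invariant_direction_pair (fst p) (snd p) t"
  obtains \<rho> where "\<rho> > 0" "\<And>t. translate_pair p t = p \<Longrightarrow> t \<noteq> 0 \<Longrightarrow> \<rho> \<le> norm t"
proof -
  let ?H = "{t. translate_pair p t = p}"
  have add: "translate_pair p (s + t) = translate_pair (translate_pair p s) t" for s t
    using p by (auto simp: translate_pair_def translate_translate)
  have zero: "translate_pair p 0 = p"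
    using p by (auto simp: translate_pair_def translate_0)
  have "closed ?H"
    unfolding translate_pair_fixed_iff[OF p]
    by (intro closed_Collect_all closed_Collect_eq continuous_intros
        continuous_on_compose2[OF profile_continuous[OF p]]) auto
  moreover have "\<exists>l. l *\<^sub>R t \<notin> ?H" if "t \<noteq> 0" for t
  proof -
    have "\<not> invariant_direction_pair (fst p) (snd p) t" using assms(2) by blast
    then show ?thesis
      using that by (auto simp: invariant_direction_pair_def translate_pair_def prod_eq_iff)
  qed
  moreover have "- t \<in> ?H" if "t \<in> ?H" for t
    using add[of t "- t"] that zero by simp
  moreover have "s + t \<in> ?H" if "s \<in> ?H" "t \<in> ?H" for s t
    using add[of s t] that by simp
  ultimately obtain \<rho> where "\<rho> > 0" "\<And>t. t \<in> ?H \<Longrightarrow> t \<noteq> 0 \<Longrightarrow> \<rho> \<le> norm t"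
    using zero closed_subgroup_discrete[of ?H] by blast
  then show ?thesis using that by blast
qed

text \<open>Rational targets slightly above the profile values at the origin replace those values.
  Each list entry takes half of the remaining error, and the triangle inequality does the
  rest.\<close>

lemma discrepancy_approx:
  assumes "e > 0"
  shows "\<exists>L. discrepancy L p 0 < e \<and>
    (\<forall>y. (\<Sum>i\<leftarrow>is. \<bar>profile i p y - profile i p 0\<bar>) - e \<le> discrepancy L p y)"
  using assms
proof (induction "is" arbitrary: e)
  case Nil
  then show ?case by (intro exI[of _ "[]"]) simp
next
  case (Cons i "is")
  obtain L where L: "discrepancy L p 0 < e / 2"
      "\<And>y. (\<Sum>i\<leftarrow>is. \<bar>profile i p y - profile i p 0\<bar>) - e / 2 \<le> discrepancy L p y"
    using Cons.IH[of "e / 2"] Cons.prems by auto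
  obtain c where c: "profile i p 0 < of_rat c" "of_rat c < profile i p 0 + e / 2"
    using of_rat_dense[of "profile i p 0" "profile i p 0 + e / 2"] Cons.prems by auto
  have "(\<Sum>i\<leftarrow>i # is. \<bar>profile i p y - profile i p 0\<bar>) - e \<le> discrepancy ((i, c) # L) p y" for y
    using L(2)[of y] c unfolding discrepancy_Cons list.map sum_list.Cons by linarith
  moreover have "discrepancy ((i, c) # L) p 0 < e"
    using L(1) c unfolding discrepancy_Cons by linarith
  ultimately show ?case by blast
qed

lemma sites_nonempty:
  fixes p :: "'a::euclidean_space measure \<times> 'a measure"
  assumes p: "p \<in> lfm_pair" and "\<nexists>t. invariant_direction_pair (fst p) (snd p) t"
  obtains \<theta> where "sites \<theta> p \<noteq> {}"
proof -
  obtain \<rho> where \<rho>: "\<rho> > 0" "\<And>t. translate_pair p t = p \<Longrightarrow> t \<noteq> 0 \<Longrightarrow> \<rho> \<le> norm t"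
    using stabilizer_discrete[OF assms] by blast
  let ?S = "sep TYPE('a)"
  have S: "?S > 0" using sep_ge[where 'a = 'a] by linarith
  \<comment> \<open>With radius \<open>1 / (m + 1)\<close> the outer radius of the annulus stays
    below \<open>\<rho>\<close>, so no nonzero element of the stabilizer lies in the
    annulus.\<close>
  obtain m where "?S / \<rho> < real (Suc m)"
    by (metis reals_Archimedean2 lessI of_nat_less_iff less_trans)
  then have m: "?S * (1 / real (Suc m)) < \<rho>"
    using \<rho>(1) by (simp add: field_simps)
  define r where "r = 1 / real (Suc m)"
  have r: "r > 0" by (simp add: r_def)
  \<comment> \<open>The closed annulus is used in order to have compactness; it contains the open
    one in \<open>valleys\<close>.\<close>
  let ?K = "{y::'a. r \<le> norm y \<and> norm y \<le> ?S * r}"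
  have "bounded ?K" by (auto simp: bounded_iff)
  moreover have "closed ?K"
    by (intro closed_Collect_conj closed_Collect_le continuous_intros)
  ultimately have K: "compact ?K" by (simp add: compact_eq_bounded_closed)
  let ?U = "\<lambda>i. {y. profile i p y \<noteq> profile i p 0}"
  have cover: "?K \<subseteq> (\<Union>i. ?U i)"
  proof
    fix y assume y: "y \<in> ?K"
    then have "y \<noteq> 0" using r by auto
    moreover have "norm (- y) < \<rho>" using y m by (simp add: r_def)
    ultimately have "translate_pair p (- y) \<noteq> p" using \<rho>(2)[of "- y"] by auto
    then show "y \<in> (\<Union>i. ?U i)"
      unfolding translate_pair_fixed_iff[OF p] by auto
  qed
  have "open (?U i)" for i
    by (intro open_Collect_neq continuous_intros profile_continuous[OF p])
  then obtain I where I: "finite I" "?K \<subseteq> (\<Union>i\<in>I. ?U i)"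
    by (rule compactE_image[OF K _ cover])
  obtain "is" where "is": "set is = I" using finite_list[OF I(1)] by blast
  let ?g = "\<lambda>y. \<Sum>i\<leftarrow>is. \<bar>profile i p y - profile i p 0\<bar>"
  have pos: "?g y > 0" if y: "y \<in> ?K" for y
  proof -
    obtain i where "i \<in> I" "profile i p y \<noteq> profile i p 0" using I(2) y by blast
    then have "0 < \<bar>profile i p y - profile i p 0\<bar>" "i \<in> set is" using "is" by auto
    moreover from this have "\<bar>profile i p y - profile i p 0\<bar> \<le> ?g y"
      by (intro member_le_sum_list) auto
    ultimately show ?thesis by linarith
  qed
  have cont: "continuous_on ?K ?g"
  proof (induction "is")
    case (Cons i "is")
    then show ?case
      by (auto intro!: continuous_intros continuous_on_subset[OF profile_continuous[OF p]])
  qed simp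
  obtain e where e: "e > 0" "\<And>y. y \<in> ?K \<Longrightarrow> e \<le> ?g y"
  proof (cases "?K = {}")
    case False
    then obtain y where "y \<in> ?K" "\<And>z. z \<in> ?K \<Longrightarrow> ?g y \<le> ?g z"
      using continuous_attains_inf[OF K False cont] by blast
    then show ?thesis using that pos by blast
  qed (use that[of 1] in auto)
  \<comment> \<open>The choice gives \<open>3 * d < e\<close>: the discrepancy is below
    \<open>d\<close> at the origin and at least \<open>e - d > 2 * d\<close> on the annulus, where
    \<open>2 * d\<close> is the threshold plus the slack \<open>1 / (n + 1)\<close>.\<close>
  obtain n where n: "3 / e < real (Suc n)"
    by (metis reals_Archimedean2 lessI of_nat_less_iff less_trans)
  define d where "d = 1 / real (Suc n)"
  have d: "d > 0" "3 * d < e" using n e(1) by (simp_all add: d_def field_simps)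
  obtain L where L: "discrepancy L p 0 < d" "\<And>y. ?g y - d \<le> discrepancy L p y"
    using discrepancy_approx[OF d(1)] by blast
  have "d + 1 / real (Suc n) \<le> discrepancy L p (0 + y)" if "r < norm y" "norm y < ?S * r" for y
  proof -
    have "e \<le> ?g y" using that by (intro e(2)) auto
    then show ?thesis using L(2)[of y] d(2) unfolding d_def[symmetric] add_0 by linarith
  qed
  then have "0 \<in> valleys d r (discrepancy L p)"
    using L(1) unfolding valleys_def by blast
  then have "0 \<in> sites (L, n, m) p"
    by (simp add: sites_def radius_def d_def r_def)
  then show ?thesis using that by blast
qed

section \<open>Nonempty factors and invariant directions\<close>

lemma random_measure_lfm:
  "random_measure \<Omega> \<Phi> \<Longrightarrow> \<omega> \<in> space \<Omega> \<Longrightarrow> \<Phi> \<omega> \<in> locally_finite_measures"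
  unfolding random_measure_def by (auto dest: measurable_space)

text \<open>Invariance would carry a single point of \<open>S\<close> along a whole segment, an
  infinite subset of \<open>S\<close> inside a compact set.\<close>

lemma counting_measure_no_invariant_direction:
  assumes S: "locally_finite_set S" "S \<noteq> {}" and t: "t \<noteq> 0"
    and inv: "\<And>l. translate (counting_measure S) (l *\<^sub>R t) = counting_measure S"
  shows False
proof -
  obtain x where x: "x \<in> S" using S by blast
  have "x + l *\<^sub>R t \<in> S" for l :: real
    using inv[of l] x unfolding counting_measure_translate counting_measure_inject by blast
  then have "(\<lambda>l. x + l *\<^sub>R t) ` {0..1} \<subseteq> S \<inter> (\<lambda>l. x + l *\<^sub>R t) ` {0..1}"
    by blast
  moreover have "compact ((\<lambda>l. x + l *\<^sub>R t) ` {0..1})"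
    by (intro compact_continuous_image continuous_intros) auto
  ultimately have "finite ((\<lambda>l. x + l *\<^sub>R t) ` {0..1})"
    using S(1) unfolding locally_finite_set_def by (meson finite_subset)
  moreover have "inj_on (\<lambda>l. x + l *\<^sub>R t) {0..1}"
    using t by (auto intro: inj_onI)
  ultimately have "finite {0..1::real}" by (rule finite_imageD)
  then show False by (simp add: infinite_Icc)
qed

lemma nonempty_pair_factor_iff:
  fixes \<Phi> \<Psi> :: "'w \<Rightarrow> 'a::euclidean_space measure"
  assumes \<Phi>: "random_measure \<Omega> \<Phi>" and \<Psi>: "random_measure \<Omega> \<Psi>"
  shows "(\<exists>P. point_process \<Omega> P \<and> equivariant_factor_pair \<Omega> \<Phi> \<Psi> P \<and> nonempty_almost_surely \<Omega> P)
    \<longleftrightarrow> (AE \<omega> in \<Omega>. \<nexists>t. invariant_direction_pair (\<Phi> \<omega>) (\<Psi> \<omega>) t)"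
proof
  assume "\<exists>P. point_process \<Omega> P \<and> equivariant_factor_pair \<Omega> \<Phi> \<Psi> P \<and> nonempty_almost_surely \<Omega> P"
  then obtain P F where PF: "\<And>\<omega>. \<omega> \<in> space \<Omega> \<Longrightarrow> P \<omega> = F (\<Phi> \<omega>, \<Psi> \<omega>)"
    and eq: "AE \<omega> in \<Omega>. \<forall>t. F (translate (\<Phi> \<omega>) t, translate (\<Psi> \<omega>) t) = translate (F (\<Phi> \<omega>, \<Psi> \<omega>)) t"
    and ne: "AE \<omega> in \<Omega>. \<exists>S. locally_finite_set S \<and> P \<omega> = counting_measure S \<and> S \<noteq> {}"
    unfolding equivariant_factor_pair_def nonempty_almost_surely_def by blast
  show "AE \<omega> in \<Omega>. \<nexists>t. invariant_direction_pair (\<Phi> \<omega>) (\<Psi> \<omega>) t"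
    using eq ne AE_space
  proof eventually_elim
    case (elim \<omega>)
    then obtain S where S: "locally_finite_set S" "S \<noteq> {}" "F (\<Phi> \<omega>, \<Psi> \<omega>) = counting_measure S"
      using PF by metis
    show ?case
    proof
      assume "\<exists>t. invariant_direction_pair (\<Phi> \<omega>) (\<Psi> \<omega>) t"
      then obtain t where "t \<noteq> 0"
          "\<And>l. translate (\<Phi> \<omega>) (l *\<^sub>R t) = \<Phi> \<omega>" "\<And>l. translate (\<Psi> \<omega>) (l *\<^sub>R t) = \<Psi> \<omega>"
        unfolding invariant_direction_pair_def by blast
      then show False
        \<comment> \<open>Equivariance at this sample passes the invariance of the pair on to its
          image under \<open>F\<close>.\<close>
        using counting_measure_no_invariant_direction[OF S(1,2)] elim(1) S(3) by metis
    qed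
  qed
next
  assume AE: "AE \<omega> in \<Omega>. \<nexists>t. invariant_direction_pair (\<Phi> \<omega>) (\<Psi> \<omega>) t"
  define P where "P = (\<lambda>\<omega>. site_process (\<Phi> \<omega>, \<Psi> \<omega>))"
  have lfm: "(\<Phi> \<omega>, \<Psi> \<omega>) \<in> lfm_pair" if "\<omega> \<in> space \<Omega>" for \<omega>
    using random_measure_lfm[OF \<Phi> that] random_measure_lfm[OF \<Psi> that] by simp
  have "random_measure \<Omega> P"
    using \<Phi> \<Psi> unfolding random_measure_def P_def
    by (intro measurable_compose[OF _ site_process_measurable] measurable_Pair)
  moreover have "\<exists>S. locally_finite_set S \<and> P \<omega> = counting_measure S" for \<omega>
    unfolding P_def site_process_def using locally_finite_points by blast
  ultimately have "point_process \<Omega> P"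
    unfolding point_process_def by simp
  moreover have "equivariant_factor_pair \<Omega> \<Phi> \<Psi> P"
    unfolding equivariant_factor_pair_def
  proof (intro bexI[OF _ site_process_measurable] conjI ballI AE_I2 allI)
    fix \<omega> t assume "\<omega> \<in> space \<Omega>"
    then show "site_process (translate (\<Phi> \<omega>) t, translate (\<Psi> \<omega>) t) =
        translate (site_process (\<Phi> \<omega>, \<Psi> \<omega>)) t"
      using site_process_translate[OF lfm, of \<omega> t] by (simp add: translate_pair_def)
  qed (simp add: P_def)
  moreover have "nonempty_almost_surely \<Omega> P"
    unfolding nonempty_almost_surely_def using AE AE_space
  proof eventually_elim
    case (elim \<omega>)
    obtain \<theta> where "sites \<theta> (\<Phi> \<omega>, \<Psi> \<omega>) \<noteq> {}"
      by (rule sites_nonempty[OF lfm[OF elim(2)], unfolded fst_conv snd_conv, OF elim(1)])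
    then show ?case
      unfolding P_def site_process_def using site_process_nonempty locally_finite_points by blast
  qed
  ultimately show "\<exists>P. point_process \<Omega> P \<and> equivariant_factor_pair \<Omega> \<Phi> \<Psi> P \<and>
      nonempty_almost_surely \<Omega> P"
    by blast
qed

text \<open>A factor map on single measures is composed with the first projection, and one on pairs
  with the diagonal embedding; both are measurable.\<close>

lemma equivariant_factor_iff_pair:
  fixes \<Phi> :: "'w \<Rightarrow> 'a::euclidean_space measure"
  shows "equivariant_factor \<Omega> \<Phi> P \<longleftrightarrow> equivariant_factor_pair \<Omega> \<Phi> \<Phi> P"
proof
  assume "equivariant_factor \<Omega> \<Phi> P"
  then obtain F where F: "F \<in> measurable vague_borel vague_borel"
      "\<forall>\<omega>\<in>space \<Omega>. P \<omega> = F (\<Phi> \<omega>)"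
      "AE \<omega> in \<Omega>. \<forall>t. F (translate (\<Phi> \<omega>) t) = translate (F (\<Phi> \<omega>)) t"
    unfolding equivariant_factor_def by blast
  have "(\<lambda>p. F (fst p)) \<in> measurable pair_borel vague_borel"
    using F(1) by measurable
  then show "equivariant_factor_pair \<Omega> \<Phi> \<Phi> P"
    unfolding equivariant_factor_pair_def using F(2,3) by (intro bexI[of _ "\<lambda>p. F (fst p)"]) auto
next
  assume "equivariant_factor_pair \<Omega> \<Phi> \<Phi> P"
  then obtain F where F: "F \<in> measurable pair_borel vague_borel"
      "\<forall>\<omega>\<in>space \<Omega>. P \<omega> = F (\<Phi> \<omega>, \<Phi> \<omega>)"
      "AE \<omega> in \<Omega>. \<forall>t. F (translate (\<Phi> \<omega>) t, translate (\<Phi> \<omega>) t) = translate (F (\<Phi> \<omega>, \<Phi> \<omega>)) t"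
    unfolding equivariant_factor_pair_def by blast
  have "(\<lambda>\<phi>. F (\<phi>, \<phi>)) \<in> measurable vague_borel vague_borel"
    using F(1) by measurable
  then show "equivariant_factor \<Omega> \<Phi> P"
    unfolding equivariant_factor_def using F(2,3) by (intro bexI[of _ "\<lambda>\<phi>. F (\<phi>, \<phi>)"]) auto
qed

theorem theorem1p1:
  fixes \<Omega> :: "'w measure"
    and \<Phi> \<Psi> :: "'w \<Rightarrow> 'a::euclidean_space measure"
  assumes "prob_space \<Omega>"
    and "random_measure \<Omega> \<Phi>"
    and "random_measure \<Omega> \<Psi>"
  shows "((\<exists>P. point_process \<Omega> P \<and> equivariant_factor_pair \<Omega> \<Phi> \<Psi> P
             \<and> nonempty_almost_surely \<Omega> P)
           \<longleftrightarrow> (AE \<omega> in \<Omega>. \<nexists>t. invariant_direction_pair (\<Phi> \<omega>) (\<Psi> \<omega>) t))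
       \<and> ((\<exists>P. point_process \<Omega> P \<and> equivariant_factor \<Omega> \<Phi> P
             \<and> nonempty_almost_surely \<Omega> P)
           \<longleftrightarrow> (AE \<omega> in \<Omega>. \<nexists>t. invariant_direction (\<Phi> \<omega>) t))"
proof -
  have "invariant_direction \<phi> t \<longleftrightarrow> invariant_direction_pair \<phi> \<phi> t" for \<phi> and t :: 'a
    by (simp add: invariant_direction_def invariant_direction_pair_def)
  then show ?thesis
    using nonempty_pair_factor_iff[OF assms(2,3)] nonempty_pair_factor_iff[OF assms(2,2)]
    by (simp add: equivariant_factor_iff_pair)
qed

end
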